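(* For any nonnegative integer $n$, the maps $\varphi_n:K(S_{n+1})\to K(B_n)$ and $\psi_n:K(B_n)\to K(S_{n+1})$ are bijections that are inverses of each other.
   Context: Notation: $[m,n]=\{m,\dots,n\}$, $[n]=[1,n]$, $\bar a=-a$. $S_n$ is the symmetric group on $[n]$ (one-line notation). $B_n$ is the group of signed permutations: bijections $w$ of $\{\pm1,\dots,\pm n\}$ with $w(-i)=-w(i)$, written $w=w_1\cdots w_n$, $w_i=w(i)$; $S_n\subseteq B_n$ consists of those with all $w_i>0$. $B_0=\{\varepsilon\}$ with $\varepsilon$ the empty signed permutation. For a word $a$ of distinct integers, $\mathrm{st}(a)\in S_m$ is the permutation with the same relative order as $a$. For a word $a=a_1\cdots a_m$ of nonzero integers with distinct absolute values, $\mathrm{sts}(a)\in B_m$ is the signed permutation whose $i$-th entry has the sign of $a_i$ and whose absolute values have the same relative order as $|a_1|,\dots,|a_m|$. $w$ contains the pattern $u\in B_m$ if $\mathrm{sts}(w_{i_1}\cdots w_{i_m})=u$ for some $i_1<\cdots<i_m$; otherwise it avoids $u$. $K(B_n)$ is the set of separable $w\in B_n$, i.e. those avoiding $\bar21$, $2\bar1$, $3142$, $2413$, $\bar3\,\bar1\,\bar4\,\bar2$, $\bar2\,\bar4\,\bar1\,\bar3$. $K(S_n)=K(B_n)\cap S_n$ is the set of permutations avoiding $3142$ and $2413$. For $u\in B_p$, $v\in B_q$: $u\oplus v\in B_{p+q}$ has $(u\oplus v)_i=u_i$ for $i\le p$ and $v_{i-p}+(\mathrm{sgn}\,v_{i-p})p$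 for $i>p$; when all entries of $u,v$ have the same sign, $u\ominus v\in B_{p+q}$ has $(u\ominus v)_i=u_i+(\mathrm{sgn}\,u_i)q$ for $i\le p$ and $v_{i-p}$ for $i>p$. $\varepsilon$ is the identity for both operations. $w_0^{S_m}=m(m-1)\cdots1$ and $w_0^{B_m}=\bar1\,\bar2\cdots\bar m$, products being compositions: for $v\in S_m$, $w_0^{B_m}w_0^{S_m}v$ has entries $-(m+1-v_i)$. For $w\in S_n$, $p\in[n-1]$ is a global ascent ($p\in\mathrm{GAsc}(w)$), resp. global descent ($p\in\mathrm{GDes}(w)$), if $w_i<w_j$, resp. $w_i>w_j$, for all $i\in[p]$, $j\in[p+1,n]$. Every separable permutation of length at least $2$ has a global ascent or a global descent. The map $\varphi_n$ is defined recursively by $\varphi_0(1)=\varepsilon$ and, for $n\ge1$ and $w\in K(S_{n+1})$, $$\varphi_n(w)=\begin{cases}\varphi_{p-1}(w_1\cdots w_p)\oplus\mathrm{st}(w_{p+1}\cdots w_{n+1}),&p\in\mathrm{GAsc}(w),\\ \varphi_{p-1}(\mathrm{st}(w_1\cdots w_p))\oplus w_0^{B_{n+1-p}}w_0^{S_{n+1-p}}(w_{p+1}\cdots w_{n+1}),&p\in\mathrm{GDes}(w),\end{cases}$$ the value being independent of the choice of $p$. The map $\psi_n$ is defined recursively by $\psi_0(\varepsilon)=1$ and, for $n\ge1$ and $w\in K(B_n)$: choose $p\in[0,n-1]$ with $w=w_1\cdots w_p\oplus\mathrm{sts}(w_{p+1}\cdots w_n)$, $w_1\cdots w_p\in K(B_p)$,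 $\mathrm{sts}(w_{p+1}\cdots w_n)\in K(B_{n-p})$ and $w_{p+1},\dots,w_n$ all of the same sign (such $p$ exists), and put $$\psi_n(w)=\begin{cases}\psi_p(w_1\cdots w_p)\oplus\mathrm{sts}(w_{p+1}\cdots w_n),&w_n>0,\\ \psi_p(w_1\cdots w_p)\ominus w_0^{S_{n-p}}w_0^{B_{n-p}}\mathrm{sts}(w_{p+1}\cdots w_n),&w_n<0,\end{cases}$$ the value being independent of the choice of $p$. *)

theory Defs
  imports Main "HOL-Library.Sublist"
begin

section \<open>Signed permutations in one-line notation\<close>

text \<open>
  A signed permutation of size \<open>n\<close> is its one-line notation, a word of integers
  \<open>w = [w(1), \<dots>, w(n)]\<close>. It stands for the odd bijection of \<open>{-n..-1} \<union> {1..n}\<close> computed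
  by \<open>act w\<close> below. List positions start at 0, so the entry \<open>w(i)\<close> is \<open>w ! (i - 1)\<close>.
  The only element of \<open>signed_perms 0\<close> is the empty word.
\<close>

definition signed_perms :: "nat \<Rightarrow> int list set" where
  "signed_perms n =
     {w. length w = n \<and> distinct (map abs w) \<and> abs ` set w = {1..int n}}"

definition perms :: "nat \<Rightarrow> int list set" where
  "perms n = {w \<in> signed_perms n. \<forall>x\<in>set w. 0 < x}"

definition act :: "int list \<Rightarrow> int \<Rightarrow> int" where
  "act w i = sgn i * w ! (nat \<bar>i\<bar> - 1)"

text \<open>One-line notation of the composition \<open>act u \<circ> act v\<close>.\<close>

definition comp_word :: "int list \<Rightarrow> int list \<Rightarrow> int list" where
  "comp_word u v = map (act u) v"

definition w0S :: "nat \<Rightarrow> int list" where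
  "w0S m = rev [1..int m]"

definition w0B :: "nat \<Rightarrow> int list" where
  "w0B m = map uminus [1..int m]"

section \<open>Standardization and patterns\<close>

text \<open>Each letter is replaced by its rank; intended for words with distinct letters.\<close>

definition st :: "int list \<Rightarrow> int list" where
  "st a = map (\<lambda>x. int (card {y \<in> set a. y \<le> x})) a"

text \<open>Intended for words of nonzero letters with distinct absolute values.\<close>

definition sts :: "int list \<Rightarrow> int list" where
  "sts a = map2 (\<lambda>x r. sgn x * r) a (st (map abs a))"

definition contains_pattern :: "int list \<Rightarrow> int list \<Rightarrow> bool" where
  "contains_pattern w u \<longleftrightarrow> (\<exists>a. subseq a w \<and> sts a = u)"

definition avoids :: "int list \<Rightarrow> int list \<Rightarrow> bool" where
  "avoids w u \<longleftrightarrow> \<not> contains_pattern w u"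

definition separable_B :: "nat \<Rightarrow> int list set" where
  "separable_B n = {w \<in> signed_perms n.
     avoids w [-2, 1] \<and> avoids w [2, -1] \<and>
     avoids w [3, 1, 4, 2] \<and> avoids w [2, 4, 1, 3] \<and>
     avoids w [-3, -1, -4, -2] \<and> avoids w [-2, -4, -1, -3]}"

definition separable_S :: "nat \<Rightarrow> int list set" where
  "separable_S n = separable_B n \<inter> perms n"

section \<open>Direct and skew sums, global ascents and descents\<close>

definition oplus :: "int list \<Rightarrow> int list \<Rightarrow> int list" (infixl \<open>\<oplus>\<close> 65) where
  "u \<oplus> v = u @ map (\<lambda>x. x + sgn x * int (length u)) v"

text \<open>Only meaningful when all entries of \<open>u\<close> and \<open>v\<close> have the same sign.\<close>

definition ominus :: "int list \<Rightarrow> int list \<Rightarrow> int list" (infixl \<open>\<ominus>\<close> 65) where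
  "u \<ominus> v = map (\<lambda>x. x + sgn x * int (length v)) u @ v"

definition GAsc :: "int list \<Rightarrow> nat set" where
  "GAsc w = {p. 1 \<le> p \<and> p < length w \<and>
     (\<forall>i j. i < p \<longrightarrow> p \<le> j \<longrightarrow> j < length w \<longrightarrow> w ! i < w ! j)}"

definition GDes :: "int list \<Rightarrow> nat set" where
  "GDes w = {p. 1 \<le> p \<and> p < length w \<and>
     (\<forall>i j. i < p \<longrightarrow> p \<le> j \<longrightarrow> j < length w \<longrightarrow> w ! i > w ! j)}"

section \<open>The maps\<close>

text \<open>
  The recursion for each map leaves open which \<open>p\<close> is used at each step. The relations below
  relate \<open>w\<close> to every value obtainable by some sequence of admissible choices, and the maps
  return the unique such value; so independence of the choices is not built in but is needed
  for the maps to have a known value.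
\<close>

inductive phi_rel :: "nat \<Rightarrow> int list \<Rightarrow> int list \<Rightarrow> bool" where
  phi_zero: "phi_rel 0 [1] []"
| phi_asc: "\<lbrakk>1 \<le> n; w \<in> separable_S (n + 1); p \<in> GAsc w; phi_rel (p - 1) (take p w) u\<rbrakk>
    \<Longrightarrow> phi_rel n w (u \<oplus> st (drop p w))"
| phi_des: "\<lbrakk>1 \<le> n; w \<in> separable_S (n + 1); p \<in> GDes w; phi_rel (p - 1) (st (take p w)) u\<rbrakk>
    \<Longrightarrow> phi_rel n w
          (u \<oplus> comp_word (w0B (n + 1 - p)) (comp_word (w0S (n + 1 - p)) (drop p w)))"

definition phi :: "nat \<Rightarrow> int list \<Rightarrow> int list" where
  "phi n w = (THE v. phi_rel n w v)"

text \<open>\<open>psi_split n w p\<close>: the number \<open>p\<close> is an admissible choice for \<open>w\<close> of length \<open>n\<close>.\<close>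

definition psi_split :: "nat \<Rightarrow> int list \<Rightarrow> nat \<Rightarrow> bool" where
  "psi_split n w p \<longleftrightarrow> p < n \<and> w = take p w \<oplus> sts (drop p w) \<and>
     take p w \<in> separable_B p \<and> sts (drop p w) \<in> separable_B (n - p) \<and>
     ((\<forall>x\<in>set (drop p w). 0 < x) \<or> (\<forall>x\<in>set (drop p w). x < 0))"

inductive psi_rel :: "nat \<Rightarrow> int list \<Rightarrow> int list \<Rightarrow> bool" where
  psi_zero: "psi_rel 0 [] [1]"
| psi_pos: "\<lbrakk>1 \<le> n; w \<in> separable_B n; psi_split n w p; 0 < last w; psi_rel p (take p w) v\<rbrakk>
    \<Longrightarrow> psi_rel n w (v \<oplus> sts (drop p w))"
| psi_neg: "\<lbrakk>1 \<le> n; w \<in> separable_B n; psi_split n w p; last w < 0; psi_rel p (take p w) v\<rbrakk>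
    \<Longrightarrow> psi_rel n w
          (v \<ominus> comp_word (w0S (n - p)) (comp_word (w0B (n - p)) (sts (drop p w))))"

definition psi :: "nat \<Rightarrow> int list \<Rightarrow> int list" where
  "psi n w = (THE v. psi_rel n w v)"

end

(* Both maps have a closed form: psi sends v to the standardization of the word 0 v, so sign
   comparisons with the prepended 0 record the signs of v. Each recursion step of phi or psi
   preserves the relation "w is order isomorphic to 0 v". Avoiding -2 1 and 2 -1 means that
   |v_i| < |v_j| whenever i < j and the signs of v_i and v_j differ; hence |v| can be recovered
   from the order of 0 v, so the relation is one-to-one, and it matches the occurrences of 3142
   and 2413 (read in the order of the integers) on both sides. It remains that the recursions
   never get stuck, i.e. that global ascents or descents and admissible splittings exist. *)

theory Submission
  imports Defs
begin

section \<open>Order isomorphism of words and standardization\<close>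

text \<open>Both maps are defined as the unique value reachable by some sequence of choices, so
  independence of the choice of \<open>p\<close> has to be obtained. Different choices are never
  compared with each other: every reachable value is related to the argument by
  \<open>std_zero\<close>, and in this relation each side determines the other. Uniqueness in both
  definite descriptions and the inverse property thus have the same source. A recursion step
  preserves the relation because the new summand has one sign and exceeds all earlier letters in
  absolute value. If positive, it lies above 0 and every earlier letter; if negative, below all of
  them. On the unsigned side this is a global ascent or a global descent. The invariant asks only
  for \<open>sign_layered\<close>, not for full separability, so no pattern argument enters its
  preservation. Avoidance is carried over once, in \<open>std_zero_separable\<close>, where the
  obstacle is that the added letter 0 might take part in an occurrence.\<close>

text \<open>Quantifying over ordered pairs of positions carries equalities over too, so repeated
  letters are handled correctly. This relation replaces computations with ranks.\<close>

definition order_iso :: "int list \<Rightarrow> int list \<Rightarrow> bool" where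
  "order_iso a b \<longleftrightarrow> length a = length b \<and>
     (\<forall>i<length a. \<forall>j<length a. a ! i < a ! j \<longleftrightarrow> b ! i < b ! j)"

lemma order_iso_refl: "order_iso a a"
  by (simp add: order_iso_def)

lemma order_iso_sym: "order_iso a b \<Longrightarrow> order_iso b a"
  by (auto simp: order_iso_def)

lemma order_iso_trans: "order_iso a b \<Longrightarrow> order_iso b c \<Longrightarrow> order_iso a c"
  by (auto simp: order_iso_def)

lemma order_iso_length: "order_iso a b \<Longrightarrow> length a = length b"
  by (simp add: order_iso_def)

lemma order_iso_map:
  assumes "\<And>x y. x \<in> set a \<Longrightarrow> y \<in> set a \<Longrightarrow> x < y \<longleftrightarrow> f x < f y"
  shows "order_iso a (map f a)"
  using assms by (simp add: order_iso_def)

lemma order_iso_append: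
  assumes iso: "order_iso a a'" "order_iso b b'"
    and cross: "\<And>k l. k < length a \<Longrightarrow> l < length b \<Longrightarrow>
      (a ! k < b ! l \<longleftrightarrow> a' ! k < b' ! l) \<and> (b ! l < a ! k \<longleftrightarrow> b' ! l < a' ! k)"
  shows "order_iso (a @ b) (a' @ b')"
  unfolding order_iso_def
proof (intro conjI allI impI)
  show "length (a @ b) = length (a' @ b')"
    using iso by (simp add: order_iso_def)
next
  fix i j assume ij: "i < length (a @ b)" "j < length (a @ b)"
  have len: "length a' = length a" "length b' = length b"
    using iso by (simp_all add: order_iso_def)
  have "i - length a < length b" if "\<not> i < length a" using that ij by simp
  moreover have "j - length a < length b" if "\<not> j < length a" using that ij by simp
  ultimately show "((a @ b) ! i < (a @ b) ! j) = ((a' @ b') ! i < (a' @ b') ! j)"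
    using iso cross[of i "j - length a"] cross[of j "i - length a"]
    by (cases "i < length a"; cases "j < length a") (simp_all add: nth_append len order_iso_def)
qed

lemma order_iso_append_less:
  assumes iso: "order_iso a a'" "order_iso b b'"
    and "\<And>x y. x \<in> set a \<Longrightarrow> y \<in> set b \<Longrightarrow> x < y"
    and "\<And>x y. x \<in> set a' \<Longrightarrow> y \<in> set b' \<Longrightarrow> x < y"
  shows "order_iso (a @ b) (a' @ b')"
proof (rule order_iso_append[OF iso])
  fix k l assume "k < length a" "l < length b"
  then have "a ! k < b ! l" "a' ! k < b' ! l"
    using assms(3,4) order_iso_length[OF iso(1)] order_iso_length[OF iso(2)] by simp_all
  then show "(a ! k < b ! l \<longleftrightarrow> a' ! k < b' ! l) \<and> (b ! l < a ! k \<longleftrightarrow> b' ! l < a' ! k)"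
    by simp
qed

lemma order_iso_append_greater:
  assumes iso: "order_iso a a'" "order_iso b b'"
    and "\<And>x y. x \<in> set a \<Longrightarrow> y \<in> set b \<Longrightarrow> y < x"
    and "\<And>x y. x \<in> set a' \<Longrightarrow> y \<in> set b' \<Longrightarrow> y < x"
  shows "order_iso (a @ b) (a' @ b')"
proof (rule order_iso_append[OF iso])
  fix k l assume "k < length a" "l < length b"
  then have "b ! l < a ! k" "b' ! l < a' ! k"
    using assms(3,4) order_iso_length[OF iso(1)] order_iso_length[OF iso(2)] by simp_all
  then show "(a ! k < b ! l \<longleftrightarrow> a' ! k < b' ! l) \<and> (b ! l < a ! k \<longleftrightarrow> b' ! l < a' ! k)"
    by simp
qed

section \<open>Permutation words and ordinary standardization\<close>

lemma perms_iff: "w \<in> perms n \<longleftrightarrow> length w = n \<and> distinct w \<and> set w = {1..int n}"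
proof
  assume w: "w \<in> perms n"
  then have pos: "\<forall>x\<in>set w. 0 < x" by (simp add: perms_def)
  then have "map abs w = w" by (intro map_idI) auto
  then show "length w = n \<and> distinct w \<and> set w = {1..int n}"
    using w list.set_map[of abs w] by (simp add: perms_def signed_perms_def)
next
  assume w: "length w = n \<and> distinct w \<and> set w = {1..int n}"
  then have "map abs w = w" by (intro map_idI) auto
  then have "distinct (map abs w)" "abs ` set w = {1..int n}"
    using w by (simp, metis list.set_map)
  then show "w \<in> perms n"
    using w by (auto simp: perms_def signed_perms_def)
qed

lemma length_st [simp]: "length (st a) = length a"
  by (simp add: st_def)

text \<open>Ranks are counted through positions instead of letters, because order isomorphism speaks
  of positions. Distinctness makes the two counts agree.\<close>

lemma st_nth:
  assumes "distinct a" "i < length a"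
  shows "st a ! i = int (card {j. j < length a \<and> a ! j \<le> a ! i})"
proof -
  have "{y \<in> set a. y \<le> a ! i} = (!) a ` {j. j < length a \<and> a ! j \<le> a ! i}"
    by (auto simp: in_set_conv_nth)
  moreover have "inj_on ((!) a) {j. j < length a \<and> a ! j \<le> a ! i}"
    using assms(1) by (auto simp: inj_on_def nth_eq_iff_index_eq)
  ultimately show ?thesis
    using assms(2) by (simp add: st_def card_image)
qed

lemma st_cong:
  assumes "order_iso a b" "distinct a" "distinct b"
  shows "st a = st b"
proof (rule nth_equalityI)
  show "length (st a) = length (st b)"
    using assms(1) by (simp add: order_iso_def)
next
  fix i assume i: "i < length (st a)"
  have "a ! j \<le> a ! i \<longleftrightarrow> b ! j \<le> b ! i" if "j < length a" for j
    using assms(1) that i by (auto simp: order_iso_def not_less[symmetric])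
  then have "{j. j < length a \<and> a ! j \<le> a ! i} = {j. j < length b \<and> b ! j \<le> b ! i}"
    using assms(1) by (auto simp: order_iso_def)
  then show "st a ! i = st b ! i"
    using st_nth assms i by (simp add: order_iso_def)
qed

lemma st_perm:
  assumes "w \<in> perms n" shows "st w = w"
  unfolding st_def
proof (rule map_idI)
  fix x assume "x \<in> set w"
  then have "{y \<in> set w. y \<le> x} = {1..x}" "1 \<le> x"
    using assms by (auto simp: perms_iff)
  then show "int (card {y \<in> set w. y \<le> x}) = x" by simp
qed

text \<open>A permutation word is its own standardization, and standardization depends only on the
  relative order. Most later identities between words are proved this way.\<close>

lemma order_iso_perms_eq:
  assumes "a \<in> perms n" "b \<in> perms n" "order_iso a b"
  shows "a = b"
  using st_cong[OF assms(3)] st_perm[OF assms(1)] st_perm[OF assms(2)] assms(1,2)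
  by (simp add: perms_iff)

lemma order_iso_st: "order_iso a (st a)"
proof -
  have mono: "card {y \<in> set a. y \<le> x} < card {y \<in> set a. y \<le> z}"
    if "x < z" "z \<in> set a" for x z
  proof (rule psubset_card_mono)
    have "z \<in> {y \<in> set a. y \<le> z} - {y \<in> set a. y \<le> x}" using that by simp
    moreover have "{y \<in> set a. y \<le> x} \<subseteq> {y \<in> set a. y \<le> z}" using that by auto
    ultimately show "{y \<in> set a. y \<le> x} \<subset> {y \<in> set a. y \<le> z}" by blast
  qed simp
  show ?thesis unfolding st_def
  proof (rule order_iso_map)
    fix x z assume "x \<in> set a" "z \<in> set a"
    then show "x < z \<longleftrightarrow> int (card {y \<in> set a. y \<le> x}) < int (card {y \<in> set a. y \<le> z})"
      using mono[of x z] mono[of z x] by (cases x z rule: linorder_cases) auto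
  qed
qed

lemma order_iso_distinct:
  assumes "order_iso a b" "distinct a" shows "distinct b"
  unfolding distinct_conv_nth
proof (intro allI impI)
  fix i j assume "i < length b" "j < length b" "i \<noteq> j"
  then have ij: "a ! i \<noteq> a ! j" "i < length a" "j < length a"
    using assms by (simp_all add: order_iso_def nth_eq_iff_index_eq)
  from ij(1) have "a ! i < a ! j \<or> a ! j < a ! i" by linarith
  with ij(2,3) have "b ! i < b ! j \<or> b ! j < b ! i"
    using assms(1) by (auto simp: order_iso_def)
  then show "b ! i \<noteq> b ! j" by auto
qed

lemma st_in_perms:
  assumes "distinct a" shows "st a \<in> perms (length a)"
proof -
  have d: "distinct (st a)"
    using order_iso_distinct[OF order_iso_st assms] .
  have "set (st a) \<subseteq> {1..int (length a)}"
  proof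
    fix x assume "x \<in> set (st a)"
    then obtain z where z: "z \<in> set a" "x = int (card {y \<in> set a. y \<le> z})"
      by (auto simp: st_def)
    have "card {y \<in> set a. y \<le> z} \<le> card (set a)"
      by (rule card_mono) auto
    moreover have "card {y \<in> set a. y \<le> z} > 0"
      using z(1) by (auto simp: card_gt_0_iff)
    ultimately show "x \<in> {1..int (length a)}"
      using z(2) card_length[of a] by auto
  qed
  moreover have "card (set (st a)) = card {1..int (length a)}"
    using distinct_card[OF d] by simp
  ultimately have "set (st a) = {1..int (length a)}"
    by (simp add: card_subset_eq)
  then show ?thesis using d by (simp add: perms_iff)
qed

lemma st_eq_iff:
  assumes "distinct a" "u \<in> perms (length a)"
  shows "st a = u \<longleftrightarrow> order_iso a u"
  using assms order_iso_st order_iso_perms_eq st_in_perms order_iso_trans order_iso_sym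
  by metis

section \<open>Signed standardization\<close>

lemma signed_perms_iff:
  "w \<in> signed_perms n \<longleftrightarrow> map abs w \<in> perms n \<and> 0 \<notin> set w"
  by (force simp: perms_iff signed_perms_def)

lemma perms_imp_signed: "w \<in> perms n \<Longrightarrow> w \<in> signed_perms n"
  by (simp add: perms_def)

lemma length_sts [simp]: "length (sts a) = length a"
  by (simp add: sts_def)

lemma sts_nth: "i < length a \<Longrightarrow> sts a ! i = sgn (a ! i) * st (map abs a) ! i"
  by (simp add: sts_def)

lemma st_pos: "x \<in> set (st a) \<Longrightarrow> 0 < x"
  by (auto simp: st_def card_gt_0_iff)

lemma abs_sts:
  assumes "0 \<notin> set a" shows "map abs (sts a) = st (map abs a)"
proof (rule nth_equalityI)
  fix i assume i: "i < length (map abs (sts a))"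
  then have "0 < st (map abs a) ! i" "a ! i \<noteq> 0"
    using st_pos[of "st (map abs a) ! i" "map abs a"] assms by (auto simp: in_set_conv_nth)
  then show "map abs (sts a) ! i = st (map abs a) ! i"
    using i by (simp add: sts_nth abs_mult)
qed simp

lemma sgn_sts:
  assumes "0 \<notin> set a" shows "map sgn (sts a) = map sgn a"
proof (rule nth_equalityI)
  fix i assume i: "i < length (map sgn (sts a))"
  then have "0 < st (map abs a) ! i"
    using st_pos[of "st (map abs a) ! i" "map abs a"] by (auto simp: in_set_conv_nth)
  then show "map sgn (sts a) ! i = map sgn a ! i"
    using i by (simp add: sts_nth sgn_mult)
qed simp

text \<open>Signs and absolute values serve as two independent coordinates: \<open>sts\<close> fixes
  the signs and standardizes the absolute values.\<close>

lemma sgn_abs_eqI: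
  fixes a b :: "int list"
  assumes "map sgn a = map sgn b" "map abs a = map abs b" shows "a = b"
proof (rule nth_equalityI)
  show "length a = length b" using assms(1) by (metis length_map)
next
  fix i assume "i < length a"
  then have "sgn (a ! i) = sgn (b ! i)" "\<bar>a ! i\<bar> = \<bar>b ! i\<bar>"
    using assms by (metis length_map nth_map)+
  then show "a ! i = b ! i" by (metis mult_sgn_abs)
qed

lemma sts_eq_iff:
  assumes "distinct (map abs a)" "0 \<notin> set a" "u \<in> signed_perms (length a)"
  shows "sts a = u \<longleftrightarrow> map sgn a = map sgn u \<and> order_iso (map abs a) (map abs u)"
proof -
  have "sts a = u \<longleftrightarrow> map sgn (sts a) = map sgn u \<and> map abs (sts a) = map abs u"
    using sgn_abs_eqI by blast
  then show ?thesis
    using assms st_eq_iff[of "map abs a" "map abs u"]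
    by (simp add: sgn_sts abs_sts signed_perms_iff)
qed

lemma sts_in_signed_perms:
  assumes "distinct (map abs a)" "0 \<notin> set a"
  shows "sts a \<in> signed_perms (length a)"
proof -
  have "0 \<notin> set (map sgn (sts a))"
    unfolding sgn_sts[OF assms(2)] using assms(2) by (auto simp: sgn_eq_0_iff)
  then have "0 \<notin> set (sts a)" by force
  then show ?thesis
    using st_in_perms[OF assms(1)] abs_sts[OF assms(2)] by (simp add: signed_perms_iff)
qed

section \<open>Separability without standardization\<close>

text \<open>For signed permutations this excludes the two patterns of length 2. Opposite signs are
  expressed by a negative product, so a letter 0 satisfies every instance vacuously and may be
  prepended freely.\<close>

definition sign_layered :: "int list \<Rightarrow> bool" where
  "sign_layered w \<longleftrightarrow>
     (\<forall>i j. i < j \<longrightarrow> j < length w \<longrightarrow> w ! i * w ! j < 0 \<longrightarrow> \<bar>w ! i\<bar> < \<bar>w ! j\<bar>)"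

text \<open>The two conjuncts exclude 3142 and 2413, the letters being compared as integers. For
  words with \<open>sign_layered\<close> this covers the patterns with all signs reversed as well: reversing
  the signs in 3142 gives a word in the relative order of 2413, and conversely.\<close>

definition avoids_simple :: "int list \<Rightarrow> bool" where
  "avoids_simple w \<longleftrightarrow> (\<forall>i j k l. i < j \<longrightarrow> j < k \<longrightarrow> k < l \<longrightarrow> l < length w \<longrightarrow>
     \<not> (w ! j < w ! l \<and> w ! l < w ! i \<and> w ! i < w ! k) \<and>
     \<not> (w ! k < w ! i \<and> w ! i < w ! l \<and> w ! l < w ! j))"

section \<open>Pattern occurrences in terms of positions\<close>

text \<open>The host word has the form \<open>drop m ys\<close> on both sides, so the equivalence
  can be applied letter by letter, with \<open>m\<close> as the lower bound for the next
  position.\<close>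

lemma subseq_Cons_drop:
  "subseq (x # xs) (drop m ys) \<longleftrightarrow>
     (\<exists>i\<ge>m. i < length ys \<and> ys ! i = x \<and> subseq xs (drop (Suc i) ys))"
proof
  assume "subseq (x # xs) (drop m ys)"
  then obtain us vs where uv: "drop m ys = us @ x # vs" "subseq xs vs"
    by (auto dest: list_emb_ConsD)
  define i where "i = m + length us"
  have "m < length ys" using uv(1) by (cases "m < length ys") auto
  then have "i < length ys"
    using arg_cong[OF uv(1), of length] by (simp add: i_def)
  moreover have "ys ! i = x"
    using arg_cong[OF uv(1), of "\<lambda>z. z ! length us"] \<open>m < length ys\<close> by (simp add: i_def)
  moreover have "drop (Suc i) ys = vs"
    using arg_cong[OF uv(1), of "drop (Suc (length us))"] by (simp add: i_def add.commute)
  ultimately show "\<exists>i\<ge>m. i < length ys \<and> ys ! i = x \<and> subseq xs (drop (Suc i) ys)"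
    using uv(2) by (intro exI[of _ i]) (auto simp: i_def)
next
  assume "\<exists>i\<ge>m. i < length ys \<and> ys ! i = x \<and> subseq xs (drop (Suc i) ys)"
  then obtain i where i: "m \<le> i" "i < length ys" "ys ! i = x" "subseq xs (drop (Suc i) ys)"
    by blast
  have "subseq (x # xs) (drop i ys)"
    using i by (simp add: Cons_nth_drop_Suc[symmetric])
  moreover have "subseq (drop i ys) (drop m ys)"
    using i(1) by (metis drop_drop le_add_diff_inverse2 suffix_drop suffix_imp_subseq)
  ultimately show "subseq (x # xs) (drop m ys)" by (rule subseq_order.trans)
qed

lemma contains_pattern_iff:
  assumes "w \<in> signed_perms n" "u \<in> signed_perms m"
  shows "contains_pattern w u \<longleftrightarrow> (\<exists>a. subseq a (drop 0 w) \<and> length a = m \<and>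
           map sgn a = map sgn u \<and> order_iso (map abs a) (map abs u))"
proof -
  have "sts a = u \<longleftrightarrow> length a = m \<and> map sgn a = map sgn u \<and> order_iso (map abs a) (map abs u)"
    if sub: "subseq a w" for a
  proof -
    obtain N where a: "a = nths w N"
      using sub by (auto simp: subseq_conv_nths)
    have "map abs a = nths (map abs w) N" by (simp add: a nths_map)
    moreover have "distinct (map abs w)" using assms(1) by (simp add: signed_perms_def)
    ultimately have "distinct (map abs a)" by simp
    moreover have "set a \<subseteq> set w"
      by (simp add: a set_nths_subset)
    then have "0 \<notin> set a"
      using assms(1) by (auto simp: signed_perms_iff)
    moreover have "length u = m" using assms(2) by (simp add: signed_perms_def)
    ultimately show ?thesis
      using sts_eq_iff[of a u] assms(2) by (cases "length a = m") auto
  qed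
  then show ?thesis unfolding contains_pattern_def by auto
qed

lemma subseq_2: "subseq [x, y] w \<longleftrightarrow> (\<exists>i j. i < j \<and> j < length w \<and> x = w ! i \<and> y = w ! j)"
proof
  assume "subseq [x, y] w"
  then have "subseq [x, y] (drop 0 w)" by simp
  then show "\<exists>i j. i < j \<and> j < length w \<and> x = w ! i \<and> y = w ! j"
    unfolding subseq_Cons_drop Suc_le_eq by metis
next
  assume "\<exists>i j. i < j \<and> j < length w \<and> x = w ! i \<and> y = w ! j"
  then obtain i j where ij: "i < j" "j < length w" "x = w ! i" "y = w ! j" by blast
  have "subseq [y] (drop (Suc i) w)"
    unfolding subseq_Cons_drop using ij by (intro exI[of _ j]) simp
  then have "subseq [x, y] (drop 0 w)"
    unfolding subseq_Cons_drop[of x] using ij by (intro exI[of _ i]) simp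
  then show "subseq [x, y] w" by simp
qed

lemma subseq_4:
  "subseq [x, y, z, t] w \<longleftrightarrow> (\<exists>i j k l. i < j \<and> j < k \<and> k < l \<and> l < length w \<and>
     x = w ! i \<and> y = w ! j \<and> z = w ! k \<and> t = w ! l)"
proof
  assume "subseq [x, y, z, t] w"
  then have "subseq [x, y, z, t] (drop 0 w)" by simp
  then show "\<exists>i j k l. i < j \<and> j < k \<and> k < l \<and> l < length w \<and>
     x = w ! i \<and> y = w ! j \<and> z = w ! k \<and> t = w ! l"
    unfolding subseq_Cons_drop Suc_le_eq by metis
next
  assume "\<exists>i j k l. i < j \<and> j < k \<and> k < l \<and> l < length w \<and>
     x = w ! i \<and> y = w ! j \<and> z = w ! k \<and> t = w ! l"
  then obtain i j k l where ij: "i < j" "j < k" "k < l" "l < length w"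
    "x = w ! i" "y = w ! j" "z = w ! k" "t = w ! l" by blast
  have "subseq [t] (drop (Suc k) w)"
    unfolding subseq_Cons_drop using ij by (intro exI[of _ l]) simp
  then have "subseq [z, t] (drop (Suc j) w)"
    unfolding subseq_Cons_drop[of z] using ij by (intro exI[of _ k]) simp
  then have "subseq [y, z, t] (drop (Suc i) w)"
    unfolding subseq_Cons_drop[of y] using ij by (intro exI[of _ j]) simp
  then have "subseq [x, y, z, t] (drop 0 w)"
    unfolding subseq_Cons_drop[of x] using ij by (intro exI[of _ i]) simp
  then show "subseq [x, y, z, t] w" by simp
qed

lemma contains_pattern_2:
  assumes "w \<in> signed_perms n" "[x, y] \<in> signed_perms 2"
  shows "contains_pattern w [x, y] \<longleftrightarrow> (\<exists>i j. i < j \<and> j < length w \<and>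
           map sgn [w ! i, w ! j] = map sgn [x, y] \<and>
           order_iso (map abs [w ! i, w ! j]) (map abs [x, y]))"
proof -
  have "contains_pattern w [x, y] \<longleftrightarrow> (\<exists>a b. subseq [a, b] w \<and>
           map sgn [a, b] = map sgn [x, y] \<and> order_iso (map abs [a, b]) (map abs [x, y]))"
    unfolding contains_pattern_iff[OF assms] by (auto simp: length_Suc_conv numeral_2_eq_2) blast
  then show ?thesis unfolding subseq_2 by blast
qed

lemma contains_pattern_4:
  assumes "w \<in> signed_perms n" "[x, y, z, t] \<in> signed_perms 4"
  shows "contains_pattern w [x, y, z, t] \<longleftrightarrow>
           (\<exists>i j k l. i < j \<and> j < k \<and> k < l \<and> l < length w \<and>
             map sgn [w ! i, w ! j, w ! k, w ! l] = map sgn [x, y, z, t] \<and>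
             order_iso (map abs [w ! i, w ! j, w ! k, w ! l]) (map abs [x, y, z, t]))"
proof -
  have "contains_pattern w [x, y, z, t] \<longleftrightarrow> (\<exists>a b c d. subseq [a, b, c, d] w \<and>
           map sgn [a, b, c, d] = map sgn [x, y, z, t] \<and>
           order_iso (map abs [a, b, c, d]) (map abs [x, y, z, t]))"
    unfolding contains_pattern_iff[OF assms] by (auto simp: length_Suc_conv eval_nat_numeral) blast
  then show ?thesis unfolding subseq_4 by blast
qed

lemma sgn_eq_1_iff: "sgn (x::int) = 1 \<longleftrightarrow> 0 < x" "sgn x = -1 \<longleftrightarrow> x < 0"
  by (auto simp: sgn_if)

lemma signed_permsI:
  assumes "length w = n" "distinct (map abs w)" "\<And>x. x \<in> set w \<Longrightarrow> 1 \<le> \<bar>x\<bar> \<and> \<bar>x\<bar> \<le> int n"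
  shows "w \<in> signed_perms n"
proof -
  have "abs ` set w \<subseteq> {1..int n}" using assms(3) by auto
  moreover have "card (abs ` set w) = card {1..int n}"
    using distinct_card[OF assms(2)] assms(1) by simp
  ultimately have "abs ` set w = {1..int n}" by (simp add: card_subset_eq)
  then show ?thesis using assms(1,2) by (simp add: signed_perms_def)
qed

lemma order_iso_21: "y < x \<Longrightarrow> order_iso [a, b] [x, y] \<longleftrightarrow> b < a"
  by (auto simp: order_iso_def All_less_Suc)

lemma order_iso_3142:
  assumes "y < t" "t < x" "x < z"
  shows "order_iso [a, b, c, d] [x, y, z, t] \<longleftrightarrow> b < d \<and> d < a \<and> a < c"
proof -
  have "y < x" "y < z" "t < z" using assms by simp_all
  then have ord: "\<not> t < y" "\<not> x < t" "\<not> z < x" "\<not> x < y" "\<not> z < y" "\<not> z < t"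
    using assms by simp_all
  show ?thesis
    unfolding order_iso_def
    by (simp add: All_less_Suc assms ord \<open>y < x\<close> \<open>y < z\<close> \<open>t < z\<close>) linarith
qed

lemma order_iso_2413:
  assumes "z < x" "x < t" "t < y"
  shows "order_iso [a, b, c, d] [x, y, z, t] \<longleftrightarrow> c < a \<and> a < d \<and> d < b"
proof -
  have "z < t" "z < y" "x < y" using assms by simp_all
  then have ord: "\<not> t < z" "\<not> y < z" "\<not> y < x" "\<not> x < z" "\<not> t < x" "\<not> y < t"
    using assms by simp_all
  show ?thesis
    unfolding order_iso_def
    by (simp add: All_less_Suc assms ord \<open>z < t\<close> \<open>z < y\<close> \<open>x < y\<close>) linarith
qed

lemma avoids_patterns_2:
  assumes "w \<in> signed_perms n"
  shows "avoids w [-2, 1] \<and> avoids w [2, -1] \<longleftrightarrow> sign_layered w"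
proof -
  have p: "[-2, 1] \<in> signed_perms 2" "[2, -1] \<in> signed_perms 2"
    by (rule signed_permsI; auto)+
  have 1: "avoids w [-2, 1] \<longleftrightarrow> (\<forall>i j. i < j \<longrightarrow> j < length w \<longrightarrow>
      \<not> (w ! i < 0 \<and> 0 < w ! j \<and> \<bar>w ! j\<bar> < \<bar>w ! i\<bar>))"
    unfolding avoids_def contains_pattern_2[OF assms p(1)]
    by (simp add: order_iso_21 sgn_eq_1_iff) blast
  have 2: "avoids w [2, -1] \<longleftrightarrow> (\<forall>i j. i < j \<longrightarrow> j < length w \<longrightarrow>
      \<not> (0 < w ! i \<and> w ! j < 0 \<and> \<bar>w ! j\<bar> < \<bar>w ! i\<bar>))"
    unfolding avoids_def contains_pattern_2[OF assms p(2)]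
    by (simp add: order_iso_21 sgn_eq_1_iff) blast
  \<comment> \<open>Avoidance only yields that the later absolute value is not smaller; excluding
    ties makes the inequality strict.\<close>
  have "\<bar>w ! i\<bar> \<noteq> \<bar>w ! j\<bar>" if "i < j" "j < length w" for i j
  proof -
    have "distinct (map abs w)" using assms by (simp add: signed_perms_def)
    then show ?thesis using that by (auto simp: distinct_conv_nth)
  qed
  then show ?thesis
    unfolding 1 2 sign_layered_def mult_less_0_iff by (meson linorder_neqE less_asym)
qed

text \<open>Two letters of equal sign with a letter of the opposite sign between them have
  increasing absolute values. In an occurrence with mixed signs, such a triple always contradicts
  the prescribed order, so all four letters share one sign. The letter at \<open>i\<close> may be 0,
  as needed for a prepended 0.\<close>

lemma sign_layered_4:
  assumes "sign_layered w" and ijkl: "i < j" "j < k" "k < l" "l < length w"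
    and nz: "w ! j \<noteq> 0" "w ! k \<noteq> 0" "w ! l \<noteq> 0"
  shows "w ! j < w ! l \<Longrightarrow> w ! l < w ! i \<Longrightarrow> w ! i < w ! k \<Longrightarrow> 0 < w ! j \<or> w ! k < 0"
    and "w ! k < w ! i \<Longrightarrow> w ! i < w ! l \<Longrightarrow> w ! l < w ! j \<Longrightarrow> 0 < w ! k \<or> w ! j < 0"
proof -
  have layer: "w ! p < 0 \<and> 0 < w ! q \<or> 0 < w ! p \<and> w ! q < 0 \<Longrightarrow> \<bar>w ! p\<bar> < \<bar>w ! q\<bar>"
    if "p < q" "q < length w" for p q
    using assms(1) that by (auto simp: sign_layered_def mult_less_0_iff)
  have "i < k" "i < l" "j < l" "j < length w" "k < length w" using ijkl by simp_all
  note ij = layer[OF ijkl(1) this(4)] and jk = layer[OF ijkl(2) this(5)]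
    and jl = layer[OF this(3) ijkl(4)] and kl = layer[OF ijkl(3) ijkl(4)]
  show "0 < w ! j \<or> w ! k < 0" if ord: "w ! j < w ! l" "w ! l < w ! i" "w ! i < w ! k"
  proof (rule ccontr)
    assume "\<not> (0 < w ! j \<or> w ! k < 0)"
    then have s: "w ! j < 0" "0 < w ! k" using nz by auto
    show False
    proof (cases "w ! l < 0")
      case True
      then show False using jk kl s ord by simp
    next
      case False
      then have "0 < w ! l" "0 < w ! i" using nz ord by auto
      then show False using ij jl s ord by simp
    qed
  qed
  show "0 < w ! k \<or> w ! j < 0" if ord: "w ! k < w ! i" "w ! i < w ! l" "w ! l < w ! j"
  proof (rule ccontr)
    assume "\<not> (0 < w ! k \<or> w ! j < 0)"
    then have s: "w ! k < 0" "0 < w ! j" using nz by auto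
    show False
    proof (cases "w ! l < 0")
      case True
      then have "w ! i < 0" using ord by simp
      then show False using ij jl s ord True by simp
    next
      case False
      then have "0 < w ! l" using nz by auto
      then show False using jk kl s ord by simp
    qed
  qed
qed

lemma avoids_patterns_4:
  assumes "w \<in> signed_perms n" "sign_layered w"
  shows "avoids w [3, 1, 4, 2] \<and> avoids w [2, 4, 1, 3] \<and>
     avoids w [-3, -1, -4, -2] \<and> avoids w [-2, -4, -1, -3] \<longleftrightarrow> avoids_simple w"
proof -
  have p: "[3, 1, 4, 2] \<in> signed_perms 4" "[2, 4, 1, 3] \<in> signed_perms 4"
    "[-3, -1, -4, -2] \<in> signed_perms 4" "[-2, -4, -1, -3] \<in> signed_perms 4"
    by (rule signed_permsI; auto)+
  \<comment> \<open>In all four equivalences the common sign is stated only for the letter closest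
    to 0; the order of the letters passes it on to the other three.\<close>
  have 1: "avoids w [3, 1, 4, 2] \<longleftrightarrow> (\<forall>i j k l. i < j \<longrightarrow> j < k \<longrightarrow> k < l \<longrightarrow> l < length w \<longrightarrow>
      \<not> (0 < w ! j \<and> w ! j < w ! l \<and> w ! l < w ! i \<and> w ! i < w ! k))"
    unfolding avoids_def contains_pattern_4[OF assms(1) p(1)]
    by (simp add: order_iso_3142 sgn_eq_1_iff) (smt (verit))
  have 2: "avoids w [2, 4, 1, 3] \<longleftrightarrow> (\<forall>i j k l. i < j \<longrightarrow> j < k \<longrightarrow> k < l \<longrightarrow> l < length w \<longrightarrow>
      \<not> (0 < w ! k \<and> w ! k < w ! i \<and> w ! i < w ! l \<and> w ! l < w ! j))"
    unfolding avoids_def contains_pattern_4[OF assms(1) p(2)]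
    by (simp add: order_iso_2413 sgn_eq_1_iff) (smt (verit))
  have 3: "avoids w [-3, -1, -4, -2] \<longleftrightarrow> (\<forall>i j k l. i < j \<longrightarrow> j < k \<longrightarrow> k < l \<longrightarrow> l < length w \<longrightarrow>
      \<not> (w ! j < 0 \<and> w ! k < w ! i \<and> w ! i < w ! l \<and> w ! l < w ! j))"
    unfolding avoids_def contains_pattern_4[OF assms(1) p(3)]
    by (simp add: order_iso_3142 sgn_eq_1_iff) (smt (verit))
  have 4: "avoids w [-2, -4, -1, -3] \<longleftrightarrow> (\<forall>i j k l. i < j \<longrightarrow> j < k \<longrightarrow> k < l \<longrightarrow> l < length w \<longrightarrow>
      \<not> (w ! k < 0 \<and> w ! j < w ! l \<and> w ! l < w ! i \<and> w ! i < w ! k))"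
    unfolding avoids_def contains_pattern_4[OF assms(1) p(4)]
    by (simp add: order_iso_2413 sgn_eq_1_iff) (smt (verit))
  have nz: "w ! m \<noteq> 0" if "m < length w" for m
    using assms(1) that nth_mem by (fastforce simp: signed_perms_iff)
  \<comment> \<open>By \<open>sign_layered_4\<close> the sign conditions hold automatically, so the
    equivalence is already true for each fixed quadruple of positions.\<close>
  have key: "\<not> (w ! j < w ! l \<and> w ! l < w ! i \<and> w ! i < w ! k) \<and>
      \<not> (w ! k < w ! i \<and> w ! i < w ! l \<and> w ! l < w ! j) \<longleftrightarrow>
      \<not> (0 < w ! j \<and> w ! j < w ! l \<and> w ! l < w ! i \<and> w ! i < w ! k) \<and>
      \<not> (0 < w ! k \<and> w ! k < w ! i \<and> w ! i < w ! l \<and> w ! l < w ! j) \<and>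
      \<not> (w ! j < 0 \<and> w ! k < w ! i \<and> w ! i < w ! l \<and> w ! l < w ! j) \<and>
      \<not> (w ! k < 0 \<and> w ! j < w ! l \<and> w ! l < w ! i \<and> w ! i < w ! k)"
    if ijkl: "i < j" "j < k" "k < l" "l < length w" for i j k l
  proof -
    have "w ! j \<noteq> 0" "w ! k \<noteq> 0" "w ! l \<noteq> 0" using nz ijkl by simp_all
    note sign_layered_4[OF assms(2) ijkl this]
    then show ?thesis by blast
  qed
  show ?thesis
    unfolding 1 2 3 4 avoids_simple_def all_conj_distrib[symmetric] imp_conjR[symmetric]
    by (intro iff_allI imp_cong refl key[symmetric])
qed

lemma separable_B_iff:
  "w \<in> separable_B n \<longleftrightarrow> w \<in> signed_perms n \<and> sign_layered w \<and> avoids_simple w"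
  using avoids_patterns_2 avoids_patterns_4 by (auto simp: separable_B_def)

lemma separable_S_iff: "w \<in> separable_S n \<longleftrightarrow> w \<in> perms n \<and> avoids_simple w"
proof -
  have "sign_layered w" if "w \<in> perms n"
    unfolding sign_layered_def
  proof (intro allI impI)
    fix i j assume "i < j" "j < length w" and neg: "w ! i * w ! j < 0"
    then have "0 < w ! i" "0 < w ! j"
      using that by (auto simp: perms_def)
    then show "\<bar>w ! i\<bar> < \<bar>w ! j\<bar>"
      using neg by (simp add: mult_less_0_iff)
  qed
  then show ?thesis
    by (auto simp: separable_S_def separable_B_iff perms_imp_signed)
qed

section \<open>Prepending the letter 0\<close>

lemma avoids_simple_order_iso:
  assumes "order_iso a b" shows "avoids_simple a \<longleftrightarrow> avoids_simple b"
proof -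
  have iso: "a ! p < a ! q \<longleftrightarrow> b ! p < b ! q" if "p < length b" "q < length b" for p q
    using assms that by (simp add: order_iso_def)
  show ?thesis
    unfolding avoids_simple_def order_iso_length[OF assms]
    by (intro iff_allI imp_cong refl) (simp add: iso)
qed

lemma avoids_simpleD:
  assumes "avoids_simple w" "i < j" "j < k" "k < l" "l < length w"
  shows "\<not> (w ! j < w ! l \<and> w ! l < w ! i \<and> w ! i < w ! k)"
    and "\<not> (w ! k < w ! i \<and> w ! i < w ! l \<and> w ! l < w ! j)"
  using assms unfolding avoids_simple_def by simp_all

lemma avoids_simple_drop:
  assumes "avoids_simple w" shows "avoids_simple (drop p w)"
  unfolding avoids_simple_def
proof (intro allI impI)
  fix i j k l assume "i < j" "j < k" "k < l" "l < length (drop p w)"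
  then show "\<not> (drop p w ! j < drop p w ! l \<and> drop p w ! l < drop p w ! i \<and> drop p w ! i < drop p w ! k) \<and>
     \<not> (drop p w ! k < drop p w ! i \<and> drop p w ! i < drop p w ! l \<and> drop p w ! l < drop p w ! j)"
    using avoids_simpleD[OF assms, of "p + i" "p + j" "p + k" "p + l"] by simp
qed

lemma avoids_simple_take:
  assumes "avoids_simple w" shows "avoids_simple (take p w)"
  using assms unfolding avoids_simple_def by simp

lemma sign_layered_take:
  assumes "sign_layered w" shows "sign_layered (take p w)"
  using assms unfolding sign_layered_def by simp

lemma sign_layered_append:
  assumes "sign_layered u" "(\<forall>y\<in>set c. 0 < y) \<or> (\<forall>y\<in>set c. y < 0)"
    and "\<And>x y. x \<in> set u \<Longrightarrow> y \<in> set c \<Longrightarrow> \<bar>x\<bar> < \<bar>y\<bar>"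
  shows "sign_layered (u @ c)"
  unfolding sign_layered_def
proof (intro allI impI)
  fix i j assume ij: "i < j" "j < length (u @ c)" and neg: "(u @ c) ! i * (u @ c) ! j < 0"
  consider "j < length u" | "i < length u" "length u \<le> j" | "length u \<le> i"
    using ij by linarith
  then show "\<bar>(u @ c) ! i\<bar> < \<bar>(u @ c) ! j\<bar>"
  proof cases
    case 1
    then show ?thesis using assms(1) ij neg by (simp add: sign_layered_def nth_append)
  next
    case 2
    then show ?thesis using assms(3) ij by (simp add: nth_append)
  next
    case 3
    then have "c ! (i - length u) \<in> set c" "c ! (j - length u) \<in> set c" using ij by simp_all
    then have "0 < (u @ c) ! i * (u @ c) ! j"
      using assms(2) 3 ij by (auto simp: nth_append intro: mult_pos_pos mult_neg_neg)
    then show ?thesis using neg by simp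
  qed
qed

lemma sign_layered_Cons_0: "sign_layered v \<Longrightarrow> sign_layered (0 # v)"
  unfolding sign_layered_def by (auto simp: nth_Cons split: nat.splits)

text \<open>A new occurrence would have to begin with 0. The first letter of 3142 or 2413 is neither
  the smallest nor the largest, so the other three letters would have mixed signs, against
  \<open>sign_layered_4\<close>.\<close>

lemma avoids_simple_Cons_0:
  assumes "0 \<notin> set v" "sign_layered v"
  shows "avoids_simple (0 # v) \<longleftrightarrow> avoids_simple v"
proof
  assume "avoids_simple (0 # v)"
  then show "avoids_simple v" using avoids_simple_drop[of "0 # v" 1] by simp
next
  assume v: "avoids_simple v"
  let ?w = "0 # v"
  show "avoids_simple ?w"
    unfolding avoids_simple_def
  proof (intro allI impI)
    fix i j k l assume ijkl: "i < j" "j < k" "k < l" "l < length ?w"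
    then obtain j' k' l' where s: "j = Suc j'" "k = Suc k'" "l = Suc l'"
      by (metis less_nat_zero_code not0_implies_Suc)
    have nz: "?w ! j \<noteq> 0" "?w ! k \<noteq> 0" "?w ! l \<noteq> 0"
      using assms(1) ijkl s by (auto simp: in_set_conv_nth)
    show "\<not> (?w ! j < ?w ! l \<and> ?w ! l < ?w ! i \<and> ?w ! i < ?w ! k) \<and>
      \<not> (?w ! k < ?w ! i \<and> ?w ! i < ?w ! l \<and> ?w ! l < ?w ! j)"
    proof (cases i)
      case 0
      then show ?thesis
        using sign_layered_4[OF sign_layered_Cons_0[OF assms(2)] ijkl nz] by auto
    next
      case (Suc i')
      then show ?thesis using avoids_simpleD[OF v, of i' j' k' l'] ijkl s by simp
    qed
  qed
qed

section \<open>The relation between a signed word and the standardization of its extension by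
  0\<close>

definition std_zero :: "nat \<Rightarrow> int list \<Rightarrow> int list \<Rightarrow> bool" where
  "std_zero n v w \<longleftrightarrow>
     v \<in> signed_perms n \<and> sign_layered v \<and> w \<in> perms (n + 1) \<and> order_iso (0 # v) w"

lemma std_zero_separable:
  assumes "std_zero n v w" shows "w \<in> separable_S (n + 1) \<longleftrightarrow> v \<in> separable_B n"
proof -
  have "avoids_simple w \<longleftrightarrow> avoids_simple v"
    using assms avoids_simple_order_iso avoids_simple_Cons_0
    by (metis signed_perms_iff std_zero_def)
  then show ?thesis
    using assms by (simp add: std_zero_def separable_S_iff separable_B_iff)
qed

lemma std_zero_right_unique:
  assumes "std_zero n v w" "std_zero n v w'" shows "w = w'"
  using assms order_iso_perms_eq order_iso_trans order_iso_sym unfolding std_zero_def by blast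

lemma sign_layered_abs_less_iff:
  assumes "sign_layered v" "i < length v" "j < length v" "v ! i * v ! j < 0"
  shows "\<bar>v ! i\<bar> < \<bar>v ! j\<bar> \<longleftrightarrow> i < j"
proof (cases i j rule: linorder_cases)
  case less
  then show ?thesis using assms by (simp add: sign_layered_def)
next
  case equal
  then show ?thesis by simp
next
  case greater
  then have "\<bar>v ! j\<bar> < \<bar>v ! i\<bar>" using assms by (simp add: sign_layered_def mult.commute)
  then show ?thesis using greater by simp
qed

text \<open>Absolute values of letters of equal sign are compared through the order of the letters,
  those of letters of opposite sign through their positions.\<close>

lemma std_zero_left_unique:
  assumes "std_zero n v w" "std_zero n v' w" shows "v = v'"
proof (rule sgn_abs_eqI)
  have v: "map abs v \<in> perms n" "map abs v' \<in> perms n" "sign_layered v" "sign_layered v'"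
    and nz: "0 \<notin> set v" "0 \<notin> set v'"
    using assms by (auto simp: std_zero_def signed_perms_iff)
  then have len: "length v = n" "length v' = n" by (auto simp: perms_iff)
  have iso: "order_iso (0 # v) (0 # v')"
    using assms order_iso_trans order_iso_sym unfolding std_zero_def by blast
  then have cmp: "(0 # v) ! i < (0 # v) ! j \<longleftrightarrow> (0 # v') ! i < (0 # v') ! j"
    if "i < Suc n" "j < Suc n" for i j
    using that len unfolding order_iso_def by simp
  have ord: "v ! i < v ! j \<longleftrightarrow> v' ! i < v' ! j" if "i < n" "j < n" for i j
    using cmp[of "Suc i" "Suc j"] that by simp
  have pos: "0 < v ! i \<longleftrightarrow> 0 < v' ! i" and neg: "v ! i < 0 \<longleftrightarrow> v' ! i < 0" if "i < n" for i
    using cmp[of 0 "Suc i"] cmp[of "Suc i" 0] that by simp_all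
  show "map sgn v = map sgn v'"
  proof (rule nth_equalityI)
    fix i assume "i < length (map sgn v)"
    then have "i < n" using len by simp
    then show "map sgn v ! i = map sgn v' ! i" using pos[of i] neg[of i] len
      by (cases "v ! i" "0 :: int" rule: linorder_cases; cases "v' ! i" "0 :: int" rule: linorder_cases) auto
  qed (simp add: len)
  have "order_iso (map abs v) (map abs v')"
    unfolding order_iso_def
  proof (intro conjI allI impI)
    fix i j assume "i < length (map abs v)" "j < length (map abs v)"
    then have ij: "i < n" "j < n" using len by simp_all
    then have "v ! i \<noteq> 0" "v ! j \<noteq> 0" using nz len by (auto simp: in_set_conv_nth)
    then consider "0 < v ! i" "0 < v ! j" | "v ! i < 0" "v ! j < 0" | "v ! i * v ! j < 0"
      by (auto simp: mult_less_0_iff neq_iff)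
    then have "\<bar>v ! i\<bar> < \<bar>v ! j\<bar> \<longleftrightarrow> \<bar>v' ! i\<bar> < \<bar>v' ! j\<bar>"
    proof cases
      case 1
      then have "0 < v' ! i" "0 < v' ! j" using pos ij by blast+
      then show ?thesis using 1 ord[OF ij] by simp
    next
      case 2
      then have "v' ! i < 0" "v' ! j < 0" using neg ij by blast+
      then show ?thesis using 2 ord[OF ij(2,1)] by simp
    next
      case 3
      then have "v' ! i * v' ! j < 0"
        using pos[of i] pos[of j] neg[of i] neg[of j] ij by (simp add: mult_less_0_iff)
      then show ?thesis using 3 v ij len sign_layered_abs_less_iff by simp
    qed
    then show "map abs v ! i < map abs v ! j \<longleftrightarrow> map abs v' ! i < map abs v' ! j"
      using ij len by simp
  qed (simp add: len)
  then show "map abs v = map abs v'" using order_iso_perms_eq v by blast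
qed

section \<open>Direct and skew sums\<close>

text \<open>For a summand of one sign the shift is a translation, which preserves relative order;
  the general shift moves positive and negative letters apart.\<close>

lemma oplus_pos:
  assumes "\<And>x. x \<in> set b \<Longrightarrow> 0 < x"
  shows "a \<oplus> b = a @ map (\<lambda>x. x + int (length a)) b"
  using assms by (simp add: oplus_def)

lemma oplus_neg:
  assumes "\<And>x. x \<in> set b \<Longrightarrow> x < 0"
  shows "a \<oplus> b = a @ map (\<lambda>x. x - int (length a)) b"
  using assms by (simp add: oplus_def)

lemma ominus_pos:
  assumes "\<And>x. x \<in> set a \<Longrightarrow> 0 < x"
  shows "a \<ominus> b = map (\<lambda>x. x + int (length b)) a @ b"
  using assms by (simp add: ominus_def)

lemma perms_bounds: "w \<in> perms n \<Longrightarrow> x \<in> set w \<Longrightarrow> 1 \<le> x \<and> x \<le> int n"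
  by (auto simp: perms_iff)

lemma permsI:
  assumes "length w = n" "distinct w" "\<And>x. x \<in> set w \<Longrightarrow> 1 \<le> x \<and> x \<le> int n"
  shows "w \<in> perms n"
proof -
  have "map abs w = w" using assms(3) by (intro map_idI) fastforce
  then have "w \<in> signed_perms n"
    using assms by (intro signed_permsI) (simp_all, fastforce+)
  then show ?thesis using assms(3) by (fastforce simp: perms_def)
qed

lemma perms_oplus:
  assumes "a \<in> perms p" "b \<in> perms q" shows "a \<oplus> b \<in> perms (p + q)"
proof -
  have ab: "length a = p" "length b = q" "distinct a" "distinct b"
    using assms by (auto simp: perms_iff)
  have "a \<oplus> b = a @ map (\<lambda>x. x + int p) b"
    using oplus_pos[of b a] perms_bounds[OF assms(2)] ab by fastforce
  then show ?thesis
    using ab perms_bounds[OF assms(1)] perms_bounds[OF assms(2)]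
    by (intro permsI) (fastforce simp: distinct_map inj_on_def)+
qed

lemma perms_ominus:
  assumes "a \<in> perms p" "b \<in> perms q" shows "a \<ominus> b \<in> perms (p + q)"
proof -
  have ab: "length a = p" "length b = q" "distinct a" "distinct b"
    using assms by (auto simp: perms_iff)
  have "a \<ominus> b = map (\<lambda>x. x + int q) a @ b"
    using ominus_pos[of a b] perms_bounds[OF assms(1)] ab by fastforce
  then show ?thesis
    using ab perms_bounds[OF assms(1)] perms_bounds[OF assms(2)]
    by (intro permsI) (fastforce simp: distinct_map inj_on_def)+
qed

lemma order_iso_shift: "order_iso a (map (\<lambda>x. x + c) a)"
  by (rule order_iso_map) simp

lemma order_iso_shift2: "order_iso (map (\<lambda>x. x + c) a) (map (\<lambda>x. x + d) a)"
  using order_iso_shift order_iso_sym order_iso_trans by blast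

lemma signed_perms_append:
  assumes "u \<in> signed_perms m" "length c = q" "distinct (map abs c)"
    and "\<And>x. x \<in> set c \<Longrightarrow> int m < \<bar>x\<bar> \<and> \<bar>x\<bar> \<le> int (m + q)"
  shows "u @ c \<in> signed_perms (m + q)"
proof (rule signed_permsI)
  have u: "length u = m" "distinct (map abs u)" "abs ` set u = {1..int m}"
    using assms(1) by (auto simp: signed_perms_def)
  then have ub: "1 \<le> \<bar>x\<bar> \<and> \<bar>x\<bar> \<le> int m" if "x \<in> set u" for x
    using that by (metis atLeastAtMost_iff image_eqI)
  show "length (u @ c) = m + q" using u assms(2) by simp
  show "1 \<le> \<bar>x\<bar> \<and> \<bar>x\<bar> \<le> int (m + q)" if "x \<in> set (u @ c)" for x
    using that ub assms(4) by fastforce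
  have "set (map abs u) \<inter> set (map abs c) = {}" using ub assms(4) by fastforce
  then show "distinct (map abs (u @ c))" using u(2) assms(3) by simp
qed

lemma signed_perms_bounds: "w \<in> signed_perms n \<Longrightarrow> x \<in> set w \<Longrightarrow> 1 \<le> \<bar>x\<bar> \<and> \<bar>x\<bar> \<le> int n"
  unfolding signed_perms_def by (metis (mono_tags, lifting) atLeastAtMost_iff image_eqI mem_Collect_eq)

text \<open>On both sides the translated copy of \<open>b\<close> lies above everything before it,
  the prepended 0 included, so the order isomorphism extends across the cut.\<close>

lemma std_zero_oplus:
  assumes "std_zero m u a" "b \<in> perms q" shows "std_zero (m + q) (u \<oplus> b) (a \<oplus> b)"
proof -
  have u: "u \<in> signed_perms m" "sign_layered u" and a: "a \<in> perms (m + 1)" and iso: "order_iso (0 # u) a"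
    using assms(1) by (auto simp: std_zero_def)
  have len: "length u = m" "length a = m + 1" "length b = q" "distinct b"
    using u a assms(2) by (auto simp: signed_perms_def perms_iff)
  note bb = perms_bounds[OF assms(2)] and ub = signed_perms_bounds[OF u(1)] and ab = perms_bounds[OF a]
  have b: "0 < x" if "x \<in> set b" for x using bb[OF that] by simp
  \<comment> \<open>The two translations differ by 1 because \<open>a\<close> has one letter more
    than \<open>u\<close>, namely the one corresponding to 0.\<close>
  have uo: "u \<oplus> b = u @ map (\<lambda>x. x + int m) b" and ao: "a \<oplus> b = a @ map (\<lambda>x. x + int (m + 1)) b"
    using oplus_pos[OF b] len by simp_all
  have "inj_on (\<lambda>x. \<bar>x + int m\<bar>) (set b)"
  proof (rule inj_onI)
    fix x y assume "x \<in> set b" "y \<in> set b" "\<bar>x + int m\<bar> = \<bar>y + int m\<bar>"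
    then show "x = y" using bb[of x] bb[of y] by linarith
  qed
  then have "distinct (map abs (map (\<lambda>x. x + int m) b))"
    using len by (simp add: distinct_map comp_def)
  then have "u \<oplus> b \<in> signed_perms (m + q)"
    unfolding uo by (rule signed_perms_append[OF u(1), rotated]) (use len bb in fastforce)+
  moreover have "sign_layered (u \<oplus> b)"
    unfolding uo using u(2) by (rule sign_layered_append) (use bb ub in fastforce)+
  moreover have "a \<oplus> b \<in> perms (m + q + 1)"
    using perms_oplus[OF a assms(2)] by (simp add: add.commute add.left_commute)
  moreover have "order_iso ((0 # u) @ map (\<lambda>x. x + int m) b) (a @ map (\<lambda>x. x + int (m + 1)) b)"
    using iso order_iso_shift2 by (rule order_iso_append_less) (use bb ub ab in fastforce)+
  ultimately show ?thesis
    unfolding std_zero_def by (simp add: uo ao)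
qed

text \<open>Subtracting q + 1 moves 1, ..., q onto -q, ..., -1 without changing the order. The
  direct sum then pushes these letters below all of \<open>0 # u\<close>, while the skew sum raises
  \<open>a\<close> above \<open>b\<close>.\<close>

lemma std_zero_ominus:
  assumes "std_zero m u a" "b \<in> perms q"
  shows "std_zero (m + q) (u \<oplus> map (\<lambda>x. x - (int q + 1)) b) (a \<ominus> b)"
proof -
  have u: "u \<in> signed_perms m" "sign_layered u" and a: "a \<in> perms (m + 1)" and iso: "order_iso (0 # u) a"
    using assms(1) by (auto simp: std_zero_def)
  have len: "length u = m" "length a = m + 1" "length b = q" "distinct b"
    using u a assms(2) by (auto simp: signed_perms_def perms_iff)
  note bb = perms_bounds[OF assms(2)] and ub = signed_perms_bounds[OF u(1)] and ab = perms_bounds[OF a]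
  let ?c = "map (\<lambda>x. x - (int q + 1)) b"
  have neg: "x < 0" if "x \<in> set ?c" for x using that bb by fastforce
  have "u \<oplus> ?c = u @ map (\<lambda>x. x - int (length u)) ?c"
    by (rule oplus_neg) (rule neg)
  then have uo: "u \<oplus> ?c = u @ map (\<lambda>x. x + - (int q + 1 + int m)) b"
    using len by (simp add: comp_def algebra_simps)
  have ao: "a \<ominus> b = map (\<lambda>x. x + int q) a @ b"
    using ominus_pos[of a b] ab len by fastforce
  have "inj_on (\<lambda>x. \<bar>x + - (int q + 1 + int m)\<bar>) (set b)"
  proof (rule inj_onI)
    fix x y assume "x \<in> set b" "y \<in> set b"
      "\<bar>x + - (int q + 1 + int m)\<bar> = \<bar>y + - (int q + 1 + int m)\<bar>"
    then show "x = y" using bb[of x] bb[of y] by linarith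
  qed
  then have "distinct (map abs (map (\<lambda>x. x + - (int q + 1 + int m)) b))"
    using len by (simp add: distinct_map comp_def)
  then have "u \<oplus> ?c \<in> signed_perms (m + q)"
    unfolding uo by (rule signed_perms_append[OF u(1), rotated]) (use len bb in fastforce)+
  moreover have "sign_layered (u \<oplus> ?c)"
    unfolding uo using u(2) by (rule sign_layered_append) (use bb ub in fastforce)+
  moreover have "a \<ominus> b \<in> perms (m + q + 1)"
    using perms_ominus[OF a assms(2)] by (simp add: add.commute add.left_commute)
  moreover have "order_iso ((0 # u) @ map (\<lambda>x. x + - (int q + 1 + int m)) b) (map (\<lambda>x. x + int q) a @ b)"
    using order_iso_trans[OF iso order_iso_shift] order_iso_sym[OF order_iso_shift]
    by (rule order_iso_append_greater) (use bb ub ab in fastforce)+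
  ultimately show ?thesis
    unfolding std_zero_def by (simp add: uo ao)
qed

section \<open>Cutting a permutation into summands\<close>

text \<open>The word and the sum of its standardized parts are order isomorphic permutations, hence
  equal; comparing prefixes then shows that the lower part was already standardized. The hypothesis
  speaks of prefix and suffix instead of \<open>GAsc\<close> so that it also covers p = 0 and the
  word of absolute values in \<open>oplus_sts\<close>.\<close>

lemma perms_split_asc:
  assumes "w \<in> perms n" "p \<le> n" "\<And>x y. x \<in> set (take p w) \<Longrightarrow> y \<in> set (drop p w) \<Longrightarrow> x < y"
  shows "take p w \<in> perms p" "st (drop p w) \<in> perms (n - p)" "w = take p w \<oplus> st (drop p w)"
proof -
  let ?a = "st (take p w)" and ?b = "st (drop p w)"
  have len: "length w = n" "distinct w" using assms(1) by (auto simp: perms_iff)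
  then have a: "?a \<in> perms p" and b: "?b \<in> perms (n - p)"
    using st_in_perms[of "take p w"] st_in_perms[of "drop p w"] assms(2) by simp_all
  have "?a \<oplus> ?b = ?a @ map (\<lambda>x. x + int p) ?b"
    using oplus_pos[of ?b ?a] perms_bounds[OF b] len assms(2) by fastforce
  moreover have "order_iso (take p w @ drop p w) (?a @ map (\<lambda>x. x + int p) ?b)"
    using order_iso_st order_iso_trans[OF order_iso_st order_iso_shift]
    by (rule order_iso_append_less) (use assms(3) perms_bounds[OF a] perms_bounds[OF b] in fastforce)+
  moreover have "?a \<oplus> ?b \<in> perms n" using perms_oplus[OF a b] assms(2) by simp
  ultimately have w: "w = ?a @ map (\<lambda>x. x + int p) ?b" "w = ?a \<oplus> ?b"
    using order_iso_perms_eq[OF assms(1)] by simp_all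
  from w(1) have "take p w = take p (?a @ map (\<lambda>x. x + int p) ?b)" by (rule arg_cong)
  then have t: "take p w = ?a" using len assms(2) by simp
  show "take p w \<in> perms p" using a t by simp
  show "?b \<in> perms (n - p)" by (rule b)
  show "w = take p w \<oplus> ?b" using w(2) t by simp
qed

lemma perms_split_des:
  assumes "w \<in> perms n" "p \<le> n" "\<And>x y. x \<in> set (take p w) \<Longrightarrow> y \<in> set (drop p w) \<Longrightarrow> y < x"
  shows "st (take p w) \<in> perms p" "drop p w \<in> perms (n - p)" "w = st (take p w) \<ominus> drop p w"
proof -
  let ?a = "st (take p w)" and ?b = "st (drop p w)"
  have len: "length w = n" "distinct w" using assms(1) by (auto simp: perms_iff)
  then have a: "?a \<in> perms p" and b: "?b \<in> perms (n - p)"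
    using st_in_perms[of "take p w"] st_in_perms[of "drop p w"] assms(2) by simp_all
  have "?a \<ominus> ?b = map (\<lambda>x. x + int (n - p)) ?a @ ?b"
    using ominus_pos[of ?a ?b] perms_bounds[OF a] len assms(2) by fastforce
  moreover have "order_iso (take p w @ drop p w) (map (\<lambda>x. x + int (n - p)) ?a @ ?b)"
    using order_iso_trans[OF order_iso_st order_iso_shift] order_iso_st
    by (rule order_iso_append_greater) (use assms(3) perms_bounds[OF a] perms_bounds[OF b] in fastforce)+
  moreover have "?a \<ominus> ?b \<in> perms n" using perms_ominus[OF a b] assms(2) by simp
  ultimately have w: "w = map (\<lambda>x. x + int (n - p)) ?a @ ?b" "w = ?a \<ominus> ?b"
    using order_iso_perms_eq[OF assms(1)] by simp_all
  from w(1) have "drop p w = drop p (map (\<lambda>x. x + int (n - p)) ?a @ ?b)" by (rule arg_cong)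
  then have t: "drop p w = ?b" using len assms(2) by simp
  show "?a \<in> perms p" by (rule a)
  show "drop p w \<in> perms (n - p)" using b t by simp
  show "w = ?a \<ominus> drop p w" using w(2) t by simp
qed

section \<open>Global ascents and descents of separable permutations\<close>

text \<open>With functions in place of lists, a descent of f is a split of -f, and shortening the
  word only lowers the bound \<open>n\<close>.\<close>

definition splits_at :: "(nat \<Rightarrow> int) \<Rightarrow> nat \<Rightarrow> nat \<Rightarrow> bool" where
  "splits_at f n p \<longleftrightarrow> 1 \<le> p \<and> p < n \<and> (\<forall>i j. i < p \<longrightarrow> p \<le> j \<longrightarrow> j < n \<longrightarrow> f i < f j)"

text \<open>Let \<open>p\<close> be the least split. If the values \<open>f i\<close>, \<open>i < p\<close>, lie on both sides of \<open>f n\<close>, then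
  avoiding 3142 (with its last two letters at positions \<open>p\<close> and \<open>n\<close>) forces all smaller ones to
  come before all larger ones, which is a split below \<open>p\<close>.\<close>

lemma splits_at_Suc:
  assumes inj: "inj_on f {..n}"
    and av: "\<And>i j k l. i < j \<Longrightarrow> j < k \<Longrightarrow> k < l \<Longrightarrow> l \<le> n \<Longrightarrow> f j < f l \<Longrightarrow> f l < f i \<Longrightarrow> \<not> f i < f k"
    and "splits_at f n p'"
  shows "\<exists>q. splits_at f (Suc n) q \<or> splits_at (\<lambda>i. - f i) (Suc n) q"
proof -
  define p where "p = (LEAST p. splits_at f n p)"
  have p: "splits_at f n p" using assms(3) unfolding p_def by (rule LeastI)
  have p_min: "\<not> splits_at f n q" if "q < p" for q using that not_less_Least unfolding p_def by blast
  have pn: "1 \<le> p" "p < n" and p_less: "\<And>i j. i < p \<Longrightarrow> p \<le> j \<Longrightarrow> j < n \<Longrightarrow> f i < f j"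
    using p by (auto simp: splits_at_def)
  have neq: "f i \<noteq> f n" if "i < n" for i using inj that by (auto simp: inj_on_def)
  consider (above) "\<forall>i<p. f i < f n" | (below) "\<forall>i<n. f n < f i"
    | (between) z y where "z < p" "f n < f z" "y < n" "f y < f n"
  proof (cases "(\<forall>i<p. f i < f n) \<or> (\<forall>i<n. f n < f i)")
    case False
    then obtain z y where "z < p" "\<not> f z < f n" "y < n" "\<not> f n < f y" by blast
    then show thesis using that(3)[of z y] neq[of z] neq[of y] pn by auto
  qed (use that(1,2) in blast)
  then show ?thesis
  proof cases
    case above
    then have "splits_at f (Suc n) p" using pn p_less by (auto simp: splits_at_def less_Suc_eq)
    then show ?thesis by blast
  next
    case below
    then have "splits_at (\<lambda>i. - f i) (Suc n) n" using pn by (auto simp: splits_at_def less_Suc_eq)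
    then show ?thesis by blast
  next
    case between
    define q where "q = (LEAST i. f n < f i)"
    have q: "f n < f q" unfolding q_def using between(2) by (rule LeastI)
    have "q \<le> z" unfolding q_def using between(2) by (rule Least_le)
    then have qp: "q < p" using between(1) by simp
    have before: "f i < f n" if "i < q" for i
      using that not_less_Least[of i "\<lambda>i. f n < f i"] neq[of i] qp pn unfolding q_def by fastforce
    have after: "f n < f j" if "q \<le> j" "j < p" for j
    proof (rule ccontr)
      assume "\<not> f n < f j"
      then have "f j < f n" "q \<noteq> j" using neq[of j] that pn q by auto
      then show False using av[of q j p n] that q qp pn p_less[of q p] by simp
    qed
    have "y < p"
    proof (rule ccontr)
      assume "\<not> y < p"
      then have "f z < f y" using p_less between by simp
      then show False using between by simp
    qed
    \<comment> \<open>This is what keeps \<open>q\<close> from being 0, as a split requires.\<close>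
    then have "y < q" using after[of y] between(4) by force
    then have "splits_at f n q"
      unfolding splits_at_def
    proof (intro conjI allI impI)
      fix i j assume ij: "i < q" "q \<le> j" "j < n"
      show "f i < f j"
      proof (cases "j < p")
        case True
        then show ?thesis using before[OF ij(1)] after[OF ij(2)] by simp
      next
        case False
        then show ?thesis using p_less ij qp by simp
      qed
    qed (use qp pn in auto)
    then show ?thesis using p_min qp by blast
  qed
qed

text \<open>Induction on the length, adding the last letter. Negation exchanges 3142 and 2413, so a
  descent of the shorter word is treated by \<open>splits_at_Suc\<close> applied to -f.\<close>

lemma splits_at_exists:
  fixes f :: "nat \<Rightarrow> int"
  assumes "2 \<le> n" "inj_on f {..<n}"
    and "\<And>i j k l. i < j \<Longrightarrow> j < k \<Longrightarrow> k < l \<Longrightarrow> l < n \<Longrightarrow> f j < f l \<Longrightarrow> f l < f i \<Longrightarrow> \<not> f i < f k"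
    and "\<And>i j k l. i < j \<Longrightarrow> j < k \<Longrightarrow> k < l \<Longrightarrow> l < n \<Longrightarrow> f k < f i \<Longrightarrow> f i < f l \<Longrightarrow> \<not> f l < f j"
  shows "\<exists>p. splits_at f n p \<or> splits_at (\<lambda>i. - f i) n p"
  using assms
proof (induction n rule: dec_induct)
  case base
  then have "f 0 \<noteq> f 1" using inj_onD[of f "{..<2}" 0 1] by auto
  then have "f 0 < f 1 \<or> f 1 < f 0" by linarith
  moreover have "splits_at g 2 1" if "g 0 < g 1" for g :: "nat \<Rightarrow> int"
    unfolding splits_at_def
  proof (intro conjI allI impI)
    fix i j :: nat assume "i < 1" "1 \<le> j" "j < 2"
    then have "i = 0" "j = 1" by simp_all
    then show "g i < g j" using that by simp
  qed simp_all
  ultimately show ?case by (metis neg_less_iff_less)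
next
  case (step n)
  have inj: "inj_on f {..n}" "inj_on (\<lambda>i. - f i) {..n}"
    using step.prems(1) by (auto simp: inj_on_def lessThan_Suc_atMost)
  have "\<exists>p. splits_at f n p \<or> splits_at (\<lambda>i. - f i) n p"
  proof (rule step.IH)
    show "inj_on f {..<n}" using inj(1) by (rule inj_on_subset) auto
  qed (use step.prems(2,3) in \<open>meson less_SucI\<close>)+
  then consider p where "splits_at f n p" | p where "splits_at (\<lambda>i. - f i) n p" by blast
  then show ?case
  proof cases
    case 1
    show ?thesis
      using inj(1) _ 1 by (rule splits_at_Suc) (use step.prems(2) in \<open>simp add: less_Suc_eq_le\<close>)
  next
    case 2
    have "\<exists>q. splits_at (\<lambda>i. - f i) (Suc n) q \<or> splits_at (\<lambda>i. - (- f i)) (Suc n) q"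
    proof (rule splits_at_Suc[OF inj(2) _ 2])
      fix i j k l assume "i < j" "j < k" "k < l" "l \<le> n" "- f j < - f l" "- f l < - f i"
      then show "\<not> - f i < - f k" using step.prems(3)[of i j k l] by auto
    qed
    then show ?thesis by auto
  qed
qed

lemma GAsc_GDes_nonempty:
  assumes "w \<in> perms n" "avoids_simple w" "2 \<le> n"
  shows "\<exists>p. p \<in> GAsc w \<or> p \<in> GDes w"
proof -
  have len: "length w = n" "distinct w" using assms(1) by (auto simp: perms_iff)
  have "\<exists>p. splits_at ((!) w) n p \<or> splits_at (\<lambda>i. - w ! i) n p"
    using assms(3)
  proof (rule splits_at_exists)
    show "inj_on ((!) w) {..<n}"
      using len by (auto simp: inj_on_def nth_eq_iff_index_eq)
  qed (use avoids_simpleD[OF assms(2)] len in blast)+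
  then show ?thesis by (simp add: splits_at_def GAsc_def GDes_def len)
qed

section \<open>Both maps standardize the word with 0 prepended\<close>

lemma act_w0S: "1 \<le> x \<Longrightarrow> x \<le> int q \<Longrightarrow> act (w0S q) x = int q + 1 - x"
  by (simp add: act_def w0S_def rev_nth nth_upto)

lemma act_w0B: "1 \<le> \<bar>x\<bar> \<Longrightarrow> \<bar>x\<bar> \<le> int q \<Longrightarrow> act (w0B q) x = - x"
  by (auto simp: act_def w0B_def nth_upto sgn_if)

text \<open>Reversal x -> q + 1 - x followed by negation is an increasing map, in fact a
  translation; hence the block keeps its relative order.\<close>

lemma comp_word_w0B_w0S:
  assumes "b \<in> perms q"
  shows "comp_word (w0B q) (comp_word (w0S q) b) = map (\<lambda>x. x - (int q + 1)) b"
  using perms_bounds[OF assms] by (force simp: comp_word_def act_w0S act_w0B)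

lemma comp_word_w0S_w0B:
  assumes "s \<in> signed_perms q" "\<forall>x\<in>set s. x < 0"
  shows "comp_word (w0S q) (comp_word (w0B q) s) = map (\<lambda>x. x + (int q + 1)) s"
  using signed_perms_bounds[OF assms(1)] assms(2) by (force simp: comp_word_def act_w0S act_w0B)

section \<open>The recursion for \<open>phi\<close>\<close>

lemma GAscD:
  assumes "p \<in> GAsc w"
  shows "1 \<le> p" "p < length w" "x \<in> set (take p w) \<Longrightarrow> y \<in> set (drop p w) \<Longrightarrow> x < y"
  using assms by (auto simp: GAsc_def in_set_conv_nth)

lemma GDesD:
  assumes "p \<in> GDes w"
  shows "1 \<le> p" "p < length w" "x \<in> set (take p w) \<Longrightarrow> y \<in> set (drop p w) \<Longrightarrow> y < x"
  using assms by (auto simp: GDes_def in_set_conv_nth)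

lemma phi_rel_std_zero: "phi_rel n w v \<Longrightarrow> std_zero n v w"
proof (induction rule: phi_rel.induct)
  case phi_zero
  show ?case by (simp add: std_zero_def signed_perms_def perms_iff sign_layered_def order_iso_refl order_iso_def)
next
  case (phi_asc n w p u)
  have w: "w \<in> perms (n + 1)" using phi_asc.hyps(2) by (simp add: separable_S_iff)
  have p: "1 \<le> p" "p \<le> n" using GAscD(1,2)[OF phi_asc.hyps(3)] w by (auto simp: perms_iff)
  have "p \<le> n + 1" using p by simp
  note split = perms_split_asc[OF w this GAscD(3)[OF phi_asc.hyps(3)]]
  \<comment> \<open>The prefix has p letters, one of which corresponds to 0, so its signed
    counterpart has size p - 1.\<close>
  have "std_zero (p - 1 + (n + 1 - p)) (u \<oplus> st (drop p w)) (take p w \<oplus> st (drop p w))"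
    using phi_asc.IH split(2) by (rule std_zero_oplus)
  moreover have "p - 1 + (n + 1 - p) = n" using p by simp
  ultimately show ?case using split(3) by simp
next
  case (phi_des n w p u)
  have w: "w \<in> perms (n + 1)" using phi_des.hyps(2) by (simp add: separable_S_iff)
  have p: "1 \<le> p" "p \<le> n" using GDesD(1,2)[OF phi_des.hyps(3)] w by (auto simp: perms_iff)
  have "p \<le> n + 1" using p by simp
  note split = perms_split_des[OF w this GDesD(3)[OF phi_des.hyps(3)]]
  have "std_zero (p - 1 + (n + 1 - p)) (u \<oplus> map (\<lambda>x. x - (int (n + 1 - p) + 1)) (drop p w))
      (st (take p w) \<ominus> drop p w)"
    using phi_des.IH split(2) by (rule std_zero_ominus)
  moreover have "p - 1 + (n + 1 - p) = n" using p by simp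
  ultimately show ?case using split(3) by (simp only: comp_word_w0B_w0S[OF split(2)])
qed

text \<open>Separability supplies the cut here, and it passes to the prefix, standardized or not,
  since avoidance depends only on relative order.\<close>

lemma phi_rel_exists: "w \<in> separable_S (n + 1) \<Longrightarrow> \<exists>v. phi_rel n w v"
proof (induction n arbitrary: w rule: less_induct)
  case (less n)
  have w: "w \<in> perms (n + 1)" "avoids_simple w" using less.prems by (auto simp: separable_S_iff)
  show ?case
  proof (cases "n = 0")
    case True
    then have "length w = 1" "set w = {1}" using w(1) by (auto simp: perms_iff)
    then have "w = [1]" by (cases w) auto
    then show ?thesis using True phi_zero by blast
  next
    case False
    then obtain p where "p \<in> GAsc w \<or> p \<in> GDes w"
      using GAsc_GDes_nonempty[OF w] by auto
    then consider "p \<in> GAsc w" | "p \<in> GDes w" by blast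
    then show ?thesis
    proof cases
      case 1
      have p: "1 \<le> p" "p \<le> n" using GAscD(1,2)[OF 1] w by (auto simp: perms_iff)
      have "take p w \<in> perms p" using perms_split_asc(1)[OF w(1) _ GAscD(3)[OF 1]] p by simp
      then have "take p w \<in> separable_S p"
        using w(2) by (simp add: separable_S_iff avoids_simple_take)
      then have "\<exists>u. phi_rel (p - 1) (take p w) u" using less.IH[of "p - 1"] p by simp
      then show ?thesis using phi_asc[OF _ less.prems 1] False by auto
    next
      case 2
      have p: "1 \<le> p" "p \<le> n" using GDesD(1,2)[OF 2] w by (auto simp: perms_iff)
      have "st (take p w) \<in> perms p" using perms_split_des(1)[OF w(1) _ GDesD(3)[OF 2]] p by simp
      then have "st (take p w) \<in> separable_S p"
        using w(2) avoids_simple_take avoids_simple_order_iso[OF order_iso_st]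
        by (simp add: separable_S_iff)
      then have "\<exists>u. phi_rel (p - 1) (st (take p w)) u" using less.IH[of "p - 1"] p by simp
      then show ?thesis using phi_des[OF _ less.prems 2] False by auto
    qed
  qed
qed

section \<open>The recursion for \<open>psi\<close>\<close>

lemma sts_set_sgn: "x \<in> set (sts a) \<Longrightarrow> 0 \<notin> set a \<Longrightarrow> \<exists>y\<in>set a. sgn x = sgn y"
  using sgn_sts[of a] by (metis (no_types, lifting) imageE image_eqI list.set_map)

lemma sts_pos: "\<forall>x\<in>set a. 0 < x \<Longrightarrow> x \<in> set (sts a) \<Longrightarrow> 0 < x"
  using sts_set_sgn[of x a] sgn_eq_1_iff(1) by (metis less_irrefl)

lemma sts_neg: "\<forall>x\<in>set a. x < 0 \<Longrightarrow> x \<in> set (sts a) \<Longrightarrow> x < 0"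
  using sts_set_sgn[of x a] sgn_eq_1_iff(2) by (metis less_irrefl)

lemma signed_permsD: "w \<in> signed_perms n \<Longrightarrow> length w = n \<and> 0 \<notin> set w"
  by (auto simp: signed_perms_iff perms_iff)

lemma psi_split_sign:
  assumes "psi_split n w p" "length w = n"
  shows "p < n" "0 < last w \<Longrightarrow> \<forall>x\<in>set (drop p w). 0 < x" "last w < 0 \<Longrightarrow> \<forall>x\<in>set (drop p w). x < 0"
proof -
  show p: "p < n" using assms(1) by (simp add: psi_split_def)
  then have "last w \<in> set (drop p w)"
    using assms(2) last_drop[of p w] last_in_set[of "drop p w"] by simp
  then show "0 < last w \<Longrightarrow> \<forall>x\<in>set (drop p w). 0 < x" "last w < 0 \<Longrightarrow> \<forall>x\<in>set (drop p w). x < 0"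
    using assms(1) unfolding psi_split_def by fastforce+
qed

lemma psi_rel_std_zero: "psi_rel n v w \<Longrightarrow> std_zero n v w"
proof (induction rule: psi_rel.induct)
  case psi_zero
  show ?case using phi_rel_std_zero[OF phi_zero] .
next
  case (psi_pos n w p v)
  have len: "length w = n" using psi_pos.hyps(2) by (simp add: separable_B_iff signed_perms_def)
  note sp = psi_split_sign[OF psi_pos.hyps(3) len]
  let ?s = "sts (drop p w)"
  have "?s \<in> signed_perms (n - p)" "w = take p w \<oplus> ?s"
    using psi_pos.hyps(3) by (simp_all add: psi_split_def separable_B_iff)
  moreover have "?s \<in> perms (n - p)"
    using calculation(1) sts_pos[OF sp(2)[OF psi_pos.hyps(4)]] by (simp add: perms_def)
  then have "std_zero (p + (n - p)) (take p w \<oplus> ?s) (v \<oplus> ?s)"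
    by (rule std_zero_oplus[OF psi_pos.IH])
  ultimately show ?case using sp(1) by simp
next
  case (psi_neg n w p v)
  have len: "length w = n" using psi_neg.hyps(2) by (simp add: separable_B_iff signed_perms_def)
  note sp = psi_split_sign[OF psi_neg.hyps(3) len]
  let ?s = "sts (drop p w)" and ?q = "n - p"
  \<comment> \<open>This is the skew summand produced by the two longest elements. Its translation
    by q + 1 is undone by the one in \<open>std_zero_ominus\<close>, which gives back
    \<open>?s\<close>.\<close>
  let ?b = "map (\<lambda>x. x + (int ?q + 1)) ?s"
  have s: "?s \<in> signed_perms ?q" "w = take p w \<oplus> ?s"
    using psi_neg.hyps(3) by (simp_all add: psi_split_def separable_B_iff)
  have neg: "\<forall>x\<in>set ?s. x < 0" using sts_neg[OF sp(3)[OF psi_neg.hyps(4)]] by blast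
  have "?b \<in> perms ?q"
  proof (rule permsI)
    show "length ?b = ?q" using len by simp
    have "distinct ?s" using s(1) by (simp add: signed_perms_def distinct_map)
    then show "distinct ?b" by (simp add: distinct_map inj_on_def)
    fix x assume "x \<in> set ?b"
    then obtain y where y: "y \<in> set ?s" "x = y + (int ?q + 1)" by auto
    then show "1 \<le> x \<and> x \<le> int ?q" using neg signed_perms_bounds[OF s(1) y(1)] by force
  qed
  then have "std_zero (p + ?q) (take p w \<oplus> map (\<lambda>x. x - (int ?q + 1)) ?b) (v \<ominus> ?b)"
    by (rule std_zero_ominus[OF psi_neg.IH])
  moreover have "map (\<lambda>x. x - (int ?q + 1)) ?b = ?s" by (simp add: comp_def)
  ultimately show ?case
    using sp(1) s(2) by (simp only: comp_word_w0S_w0B[OF s(1) neg]) simp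
qed

text \<open>The word of absolute values is cut by \<open>perms_split_asc\<close>. The signs need no
  further condition, because both \<open>sts\<close> and the shift in a direct sum preserve
  them.\<close>

lemma oplus_sts:
  assumes v: "v \<in> signed_perms n" and "p \<le> n"
    and less: "\<And>x y. x \<in> set (take p v) \<Longrightarrow> y \<in> set (drop p v) \<Longrightarrow> \<bar>x\<bar> < \<bar>y\<bar>"
  shows "take p v \<in> signed_perms p" "sts (drop p v) \<in> signed_perms (n - p)"
    "v = take p v \<oplus> sts (drop p v)"
proof -
  have m: "map abs v \<in> perms n" and nz: "0 \<notin> set v" using v by (auto simp: signed_perms_iff)
  then have len: "length v = n" "distinct (map abs v)" by (auto simp: perms_iff)
  have "x < y" if "x \<in> set (take p (map abs v))" "y \<in> set (drop p (map abs v))" for x y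
    using that less by (auto simp: take_map drop_map)
  note split = perms_split_asc[OF m assms(2) this]
  have nzs: "0 \<notin> set (take p v)" "0 \<notin> set (drop p v)"
    using nz in_set_takeD in_set_dropD by metis+
  show "take p v \<in> signed_perms p"
    using split(1) nzs(1) by (simp add: signed_perms_iff take_map)
  have "distinct (map abs (drop p v))" using len(2) by (simp add: drop_map[symmetric])
  then show s: "sts (drop p v) \<in> signed_perms (n - p)"
    using sts_in_signed_perms[OF _ nzs(2)] len by simp
  show "v = take p v \<oplus> sts (drop p v)"
  proof (rule sgn_abs_eqI)
    let ?t = "sts (drop p v)" and ?l = "length (take p v)"
    have sg: "sgn (x + sgn x * int k) = sgn x" "\<bar>x + sgn x * int k\<bar> = \<bar>x\<bar> + int k"
      if "x \<noteq> 0" for x :: int and k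
      using that by (auto simp: sgn_if)
    have tnz: "x \<noteq> 0" if "x \<in> set ?t" for x using s that by (auto simp: signed_perms_iff)
    have "map sgn (take p v \<oplus> ?t) = map sgn (take p v) @ map sgn ?t"
      using sg(1) tnz by (simp add: oplus_def)
    then show "map sgn v = map sgn (take p v \<oplus> ?t)"
      using sgn_sts[OF nzs(2)] by (simp add: take_map[symmetric] drop_map[symmetric])
    have "map abs (take p v \<oplus> ?t) = map abs (take p v) @ map (\<lambda>x. x + int ?l) (map abs ?t)"
      using sg(2) tnz by (simp add: oplus_def)
    also have "\<dots> = take p (map abs v) @ map (\<lambda>x. x + int (length (take p (map abs v)))) (st (drop p (map abs v)))"
      using abs_sts[OF nzs(2)] by (simp add: take_map drop_map)
    also have "\<dots> = take p (map abs v) \<oplus> st (drop p (map abs v))"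
      using st_pos by (intro oplus_pos[symmetric])
    finally show "map abs v = map abs (take p v \<oplus> ?t)" using split(3) by simp
  qed
qed

text \<open>The longest final block of letters of one sign is an admissible summand. The main point
  is that its absolute values exceed all earlier ones, including those of earlier letters with the
  same sign.\<close>

lemma psi_split_exists:
  assumes "v \<in> separable_B n" "1 \<le> n"
  shows "\<exists>p. psi_split n v p"
proof -
  have v: "v \<in> signed_perms n" "sign_layered v" "avoids_simple v"
    using assms(1) by (auto simp: separable_B_iff)
  then have len: "length v = n" and nz: "0 \<notin> set v" by (auto dest: signed_permsD)
  define P where "P p \<longleftrightarrow> p < n \<and> (\<forall>j. p \<le> j \<longrightarrow> j < n \<longrightarrow> sgn (v ! j) = sgn (last v))" for p
  define p where "p = (LEAST p. P p)"
  have "P (n - 1)"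
    unfolding P_def
  proof (intro conjI allI impI)
    fix j assume "n - 1 \<le> j" "j < n"
    then have "j = length v - 1" using len by simp
    then show "sgn (v ! j) = sgn (last v)"
      using len assms(2) last_conv_nth[of v] by fastforce
  qed (use assms(2) in simp)
  then have p: "P p" unfolding p_def by (rule LeastI)
  then have pn: "p < n" by (simp add: P_def)
  have opp: "v ! i * v ! j < 0" if "sgn (v ! i) \<noteq> sgn (v ! j)" "i < n" "j < n" for i j
  proof -
    have "v ! i \<noteq> 0" "v ! j \<noteq> 0" using that nz len by (auto simp: in_set_conv_nth)
    then show ?thesis using that(1) by (auto simp: sgn_if mult_less_0_iff split: if_splits)
  qed
  have less: "\<bar>v ! i\<bar> < \<bar>v ! j\<bar>" if ij: "i < p" "p \<le> j" "j < n" for i j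
  proof (cases "sgn (v ! i) = sgn (v ! j)")
    case False
    then show ?thesis using opp[of i j] ij v(2) len by (simp add: sign_layered_def)
  next
    case True
    \<comment> \<open>Since the block cannot be extended, the letter at p - 1 has the opposite sign
      to those at \<open>i\<close> and \<open>j\<close> and lies between them; comparing both with
      it gives the inequality.\<close>
    have "p - 1 < p" using ij(1) by simp
    then have "\<not> P (p - 1)" using not_less_Least[of "p - 1" P] unfolding p_def by blast
    moreover have "p - 1 < n" using pn by simp
    ultimately obtain k where k: "p - 1 \<le> k" "k < n" "sgn (v ! k) \<noteq> sgn (last v)"
      unfolding P_def by blast
    then have "\<not> p \<le> k" using p unfolding P_def by blast
    then have kp: "k = p - 1" using k(1) by simp
    have sj: "sgn (v ! j) = sgn (last v)" using p ij by (simp add: P_def)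
    then have "i \<noteq> k" using k(3) True by auto
    then have "i < k" "k < j" using ij kp by auto
    moreover have "v ! i * v ! k < 0" "v ! k * v ! j < 0"
      using opp[of i k] opp[of k j] k sj True ij by auto
    ultimately have "\<bar>v ! i\<bar> < \<bar>v ! k\<bar>" "\<bar>v ! k\<bar> < \<bar>v ! j\<bar>"
      using v(2) len ij k(2) by (auto simp: sign_layered_def)
    then show ?thesis by simp
  qed
  have "\<bar>x\<bar> < \<bar>y\<bar>" if "x \<in> set (take p v)" "y \<in> set (drop p v)" for x y
    using that less len pn by (auto simp: in_set_conv_nth)
  note split = oplus_sts[OF v(1) less_imp_le[OF pn] this]
  let ?s = "sts (drop p v)"
  have sgnd: "sgn x = sgn (last v)" if "x \<in> set (drop p v)" for x
    using that p len by (auto simp: in_set_conv_nth P_def)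
  have last: "last v \<noteq> 0" using nz len assms(2) last_in_set[of v] by fastforce
  then have sign: "(\<forall>x\<in>set (drop p v). 0 < x) \<or> (\<forall>x\<in>set (drop p v). x < 0)"
    using sgnd sgn_eq_1_iff by (metis linorder_neqE)
  then have sign_s: "(\<forall>x\<in>set ?s. 0 < x) \<or> (\<forall>x\<in>set ?s. x < 0)"
    using sts_pos sts_neg by blast
  have "sign_layered ?s"
    using sign_layered_append[of "[]" ?s] sign_s by (simp add: sign_layered_def)
  \<comment> \<open>As \<open>?s\<close> has letters of one sign, \<open>drop p v\<close> is a
    translate of it. Standardizing the absolute values has thus kept the order of the letters as
    integers.\<close>
  moreover have "avoids_simple ?s"
  proof -
    have "\<exists>c. drop p v = map (\<lambda>x. x + c) ?s"
    proof -
      have "drop p v = drop p (take p v \<oplus> ?s)" using split(3) by simp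
      also have "\<dots> = map (\<lambda>x. x + sgn x * int p) ?s" using len pn by (simp add: oplus_def)
      finally have *: "drop p v = map (\<lambda>x. x + sgn x * int p) ?s" .
      show ?thesis
        using sign_s
      proof
        assume "\<forall>x\<in>set ?s. 0 < x"
        then have "map (\<lambda>x. x + sgn x * int p) ?s = map (\<lambda>x. x + int p) ?s" by simp
        then show ?thesis by (intro exI[of _ "int p"]) (rule trans[OF *])
      next
        assume "\<forall>x\<in>set ?s. x < 0"
        then have "map (\<lambda>x. x + sgn x * int p) ?s = map (\<lambda>x. x + - int p) ?s" by simp
        then show ?thesis by (intro exI[of _ "- int p"]) (rule trans[OF *])
      qed
    qed
    then have "order_iso ?s (drop p v)" using order_iso_shift by metis
    then show ?thesis using avoids_simple_order_iso avoids_simple_drop[OF v(3)] by blast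
  qed
  ultimately have "psi_split n v p"
    using split v sign pn sign_layered_take avoids_simple_take
    by (simp add: psi_split_def separable_B_iff)
  then show ?thesis by blast
qed

lemma psi_rel_exists: "v \<in> separable_B n \<Longrightarrow> \<exists>w. psi_rel n v w"
proof (induction n arbitrary: v rule: less_induct)
  case (less n)
  have len: "length v = n" and nz: "0 \<notin> set v"
    using less.prems by (auto simp: separable_B_iff dest: signed_permsD)
  show ?case
  proof (cases "n = 0")
    case True
    then show ?thesis using len psi_zero by auto
  next
    case False
    then obtain p where p: "psi_split n v p" using psi_split_exists less.prems by fastforce
    then obtain u where u: "psi_rel p (take p v) u"
      using less.IH[of p "take p v"] by (auto simp: psi_split_def)
    have "v \<noteq> []" using len False by auto
    then have "last v \<noteq> 0" using nz last_in_set[of v] by metis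
    then consider "0 < last v" | "last v < 0" by linarith
    then show ?thesis
      using psi_pos[OF _ less.prems p _ u] psi_neg[OF _ less.prems p _ u] False
      by cases auto
  qed
qed

section \<open>Both maps as the two directions of one relation\<close>

text \<open>One reachable value exists, and any other is related to the same \<open>w\<close> by
  \<open>std_zero\<close>, hence equal to it. This settles the independence of the choices.\<close>

lemma phi_eq_iff:
  assumes "w \<in> separable_S (n + 1)" shows "phi n w = v \<longleftrightarrow> std_zero n v w"
proof -
  obtain v' where v': "phi_rel n w v'" using phi_rel_exists[OF assms] by blast
  have "phi n w = v'"
    unfolding phi_def using v' phi_rel_std_zero std_zero_left_unique by (intro the_equality) blast+
  then show ?thesis using phi_rel_std_zero[OF v'] std_zero_left_unique by blast
qed

lemma psi_eq_iff:
  assumes "v \<in> separable_B n" shows "psi n v = w \<longleftrightarrow> std_zero n v w"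
proof -
  obtain w' where w': "psi_rel n v w'" using psi_rel_exists[OF assms] by blast
  have "psi n v = w'"
    unfolding psi_def using w' psi_rel_std_zero std_zero_right_unique by (intro the_equality) blast+
  then show ?thesis using psi_rel_std_zero[OF w'] std_zero_right_unique by blast
qed

theorem theorem4p3:
  fixes n :: nat
  shows "bij_betw (phi n) (separable_S (n + 1)) (separable_B n) \<and>
         bij_betw (psi n) (separable_B n) (separable_S (n + 1)) \<and>
         (\<forall>w \<in> separable_S (n + 1). psi n (phi n w) = w) \<and>
         (\<forall>v \<in> separable_B n. phi n (psi n v) = v)"
proof -
  have phi: "phi n w \<in> separable_B n \<and> psi n (phi n w) = w" if "w \<in> separable_S (n + 1)" for w
  proof -
    have z: "std_zero n (phi n w) w" by (rule phi_eq_iff[OF that, THEN iffD1, OF refl])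
    then have "phi n w \<in> separable_B n" using std_zero_separable that by simp
    then show ?thesis using psi_eq_iff z by simp
  qed
  have psi: "psi n v \<in> separable_S (n + 1) \<and> phi n (psi n v) = v" if "v \<in> separable_B n" for v
  proof -
    have z: "std_zero n v (psi n v)" by (rule psi_eq_iff[OF that, THEN iffD1, OF refl])
    then have "psi n v \<in> separable_S (n + 1)" using std_zero_separable that by simp
    then show ?thesis using phi_eq_iff z by simp
  qed
  have "bij_betw (phi n) (separable_S (n + 1)) (separable_B n)"
    by (rule bij_betw_byWitness[where f' = "psi n"]) (use phi psi in auto)
  moreover have "bij_betw (psi n) (separable_B n) (separable_S (n + 1))"
    by (rule bij_betw_byWitness[where f' = "phi n"]) (use phi psi in auto)
  ultimately show ?thesis using phi psi by blast
qed

end
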